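(* Suppose that either $(G,d(\cdot))$ is piecewise $\mathcal C^1$ with continuous reflection and $G$ is bounded, or $(G,d(\cdot))$ is polyhedral with piecewise constant reflection. If $\mathcal V\subset\partial G$ satisfies Assumption 2' and the drift and dispersion coefficients $b(\cdot)$ and $\sigma(\cdot)$ are continuous and uniformly bounded, then Assumption TF and Assumption V (stated in the context) are satisfied.
   Context: Notation: $\langle\cdot,\cdot\rangle$, $|\cdot|$ Euclidean; $B_r(x)=\{y\in\mathbb R^J:|y-x|\le r\}$, $\mathrm{dist}(y,A)=\inf_{z\in A}|y-z|$. $b:\mathbb R^J\to\mathbb R^J$, $\sigma:\mathbb R^J\to\mathbb R^{J\times N}$, $a=\sigma\sigma^T$, $\mathcal Lf=\sum_i b_i\partial_{x_i}f+\frac12\sum_{i,j}a_{ij}\partial^2_{x_ix_j}f$. Piecewise $\mathcal C^1$ with continuous reflection: $G=\bigcap_{i\in\mathcal I}G_i$ is a nonempty domain, $\mathcal I$ finite, each $G_i=\{x:\phi^i(x)>0\}$ with $\partial G_i=\{x:\phi^i(x)=0\}$ for some continuously differentiable $\phi^i$ on $\mathbb R^J$; $n^i(x)$ is the unit inward normal to $\partial G_i$ at $x\in\partial G_i$; $\mathcal I(x)=\{i\in\mathcal I:x\in\partial G_i\}$; $n(x)=\{\sum_{i\in\mathcal I(x)}s_in^i(x):s_i\ge0\}$ for $x\in\partial G$; for each $i$, $\gamma^i(\cdot)$ is a continuous vector field on $\partial G_i$ with $\langle n^i(x),\gamma^i(x)\rangle>0$, and $d(x)=\{\sum_{i\in\mathcal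 I(x)}s_i\gamma^i(x):s_i\ge0\}$ for $x\in\partial G$, $d(x)=\{0\}$ for $x\in G$. Polyhedral with piecewise constant reflection: additionally all $n^i(\cdot)$ and $\gamma^i(\cdot)$ are constant. $\mathcal U=\{x\in\partial G:\exists n\in n(x)\text{ with }\langle n,d\rangle>0\ \forall d\in d(x)\setminus\{0\}\}$. Assumption 2': $\mathcal V$ is a finite set with $\mathcal V\supset\partial G\setminus\mathcal U$, and for each $x\in\mathcal V$ there exist a unit vector $v_x$ and constants $r_x>0$, $\alpha_x>0$, $0<c^1_x<1<c^2_x<\infty$ such that, with $\Theta_x=\{z:\langle z,v_x\rangle\ge0\}$, for all $y\in\overline G\cap B_{r_x}(x)$: (1) $\langle v_x,y-x\rangle\ge\alpha_x|y-x|$; (2) $\gamma^i(y)\in\Theta_x$ for each $i\in\mathcal I(y)\subset\mathcal I(x)$; (3) for every $r\in(0,r_x/c^2_x)$, $\overline G\cap B_{c^1_xr}(x)\subseteq\{y\in\overline G\cap B_{r_x}(x):\mathrm{dist}(y,x+rv_x+\Theta_x)>0\}\subseteq\overline G\cap B_{c^2_xr}(x)$; (4) $v_x^Ta(y)v_x\ge\alpha_x$ for all $y\in B_{r_x}(x)$. Function spaces: $\mathcal C^2(\overline G)$ are restrictions to $\overline G$ of functions $\mathcal C^2$ on every open neighbourhood of $\overline G$; subscripts $b$, $c$ mean bounded with bounded derivatives up to order 2, resp. compact support; $\mathcal C^2_c(\overline G)\oplus\mathbb R$ are sums of a $\mathcal C^2_c(\overline G)$ function and a constant. $f$ is constant in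 a neighbourhood of $\mathcal V$ if it is constant near each point of $\mathcal V$. $\mathcal H=\{f\in\mathcal C^2_c(\overline G)\oplus\mathbb R: f\text{ constant in a neighbourhood of }\mathcal V,\ \langle d,\nabla f(y)\rangle\le0\ \forall d\in d(y),y\in\partial G\}$. Assumption TF: for each $\varepsilon>0$, $N\in\mathbb N$ there exist nonnegative $\{f_{x,\varepsilon}\in\mathcal C^2_b(\overline G):x\in\overline G\cap B_N(0)\}$ and constants $C(N,\varepsilon),c(N,\varepsilon)>0$ with: (1) each $f_{x,\varepsilon}$ is a finite or countable sum of functions in $\mathcal H\cap\mathcal C^2_c(\overline G)$; (2) $f_{x,\varepsilon}(y)=0$ if $|y-x|\le\varepsilon/2$ and $f_{x,\varepsilon}(y)>c(N,\varepsilon)$ if $|y-x|>3\varepsilon$, $y\in\overline G$; (3) $|\mathcal Lf_{x,\varepsilon}(y)|\le C(N,\varepsilon)$ for all $y\in\overline G$. Assumption V: $\mathcal V$ is finite and for each $x\in\mathcal V$ there exist a unit vector $v_x$ and $\alpha_x,r_x>0$ with $\langle v_x,y-x\rangle\ge\alpha_x|y-x|$, $v_x^Ta(y)v_x\ge\alpha_x$ and $\langle v_x,d\rangle\ge0$ for all $d\in d(y)$, $y\in\overline G\cap B_{r_x}(x)$. *)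

theory Defs
  imports "HOL-Analysis.Analysis"
begin

definition pd :: "'J::finite \<Rightarrow> (real^'J \<Rightarrow> real) \<Rightarrow> real^'J \<Rightarrow> real" where
  "pd i f x = frechet_derivative f (at x) (axis i 1)"

definition grad :: "(real^'J::finite \<Rightarrow> real) \<Rightarrow> real^'J \<Rightarrow> real^'J" where
  "grad f x = (\<chi> i. pd i f x)"

definition C1_fun :: "(real^'J::finite \<Rightarrow> real) \<Rightarrow> bool" where
  "C1_fun f \<longleftrightarrow> (\<forall>x. f differentiable (at x)) \<and> (\<forall>k. continuous_on UNIV (pd k f))"

definition C2_on :: "(real^'J::finite) set \<Rightarrow> (real^'J \<Rightarrow> real) \<Rightarrow> bool" where
  "C2_on U f \<longleftrightarrow> open U \<and> (\<forall>x\<in>U. f differentiable (at x))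
     \<and> (\<forall>j. \<forall>x\<in>U. pd j f differentiable (at x))
     \<and> (\<forall>i j. continuous_on U (pd i (pd j f)))"

definition C2_near :: "(real^'J::finite) set \<Rightarrow> (real^'J \<Rightarrow> real) \<Rightarrow> bool" where
  "C2_near S f \<longleftrightarrow> (\<exists>U. S \<subseteq> U \<and> C2_on U f)"

definition C2b :: "(real^'J::finite) set \<Rightarrow> (real^'J \<Rightarrow> real) \<Rightarrow> bool" where
  "C2b S f \<longleftrightarrow> C2_near S f \<and> bounded (f ` S) \<and> (\<forall>i. bounded (pd i f ` S))
     \<and> (\<forall>i j. bounded (pd i (pd j f) ` S))"

definition C2c :: "(real^'J::finite) set \<Rightarrow> (real^'J \<Rightarrow> real) \<Rightarrow> bool" where
  "C2c S f \<longleftrightarrow> C2_near S f \<and> bounded {y\<in>S. f y \<noteq> 0}"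

definition C2c_plus :: "(real^'J::finite) set \<Rightarrow> (real^'J \<Rightarrow> real) \<Rightarrow> bool" where
  "C2c_plus S f \<longleftrightarrow> (\<exists>g c. C2c S g \<and> f = (\<lambda>y. g y + c))"

definition amat :: "(real^'J::finite \<Rightarrow> real^'N::finite^'J) \<Rightarrow> real^'J \<Rightarrow> real^'J^'J" where
  "amat \<sigma> y = \<sigma> y ** transpose (\<sigma> y)"

definition Lgen :: "(real^'J::finite \<Rightarrow> real^'J) \<Rightarrow> (real^'J \<Rightarrow> real^'N::finite^'J)
     \<Rightarrow> (real^'J \<Rightarrow> real) \<Rightarrow> real^'J \<Rightarrow> real" where
  "Lgen b \<sigma> f y = (\<Sum>i\<in>UNIV. b y $ i * pd i f y)
      + 1/2 * (\<Sum>i\<in>UNIV. \<Sum>j\<in>UNIV. amat \<sigma> y $ i $ j * pd i (pd j f) y)"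

definition Gi :: "('i \<Rightarrow> real^'J::finite \<Rightarrow> real) \<Rightarrow> 'i \<Rightarrow> (real^'J) set" where
  "Gi \<phi> i = {x. \<phi> i x > 0}"

definition GG :: "'i set \<Rightarrow> ('i \<Rightarrow> real^'J::finite \<Rightarrow> real) \<Rightarrow> (real^'J) set" where
  "GG I \<phi> = (\<Inter>i\<in>I. Gi \<phi> i)"

text \<open>Unit inward normal to the boundary of G_i = {phi_i > 0}.\<close>
definition nrm :: "('i \<Rightarrow> real^'J::finite \<Rightarrow> real) \<Rightarrow> 'i \<Rightarrow> real^'J \<Rightarrow> real^'J" where
  "nrm \<phi> i x = (1 / norm (grad (\<phi> i) x)) *\<^sub>R grad (\<phi> i) x"

definition Idx :: "'i set \<Rightarrow> ('i \<Rightarrow> real^'J::finite \<Rightarrow> real) \<Rightarrow> real^'J \<Rightarrow> 'i set" where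
  "Idx I \<phi> x = {i\<in>I. x \<in> frontier (Gi \<phi> i)}"

definition ncone :: "'i set \<Rightarrow> ('i \<Rightarrow> real^'J::finite \<Rightarrow> real) \<Rightarrow> real^'J \<Rightarrow> (real^'J) set" where
  "ncone I \<phi> x = {(\<Sum>i\<in>Idx I \<phi> x. s i *\<^sub>R nrm \<phi> i x) | s. \<forall>i\<in>Idx I \<phi> x. 0 \<le> s i}"

definition dcone :: "'i set \<Rightarrow> ('i \<Rightarrow> real^'J::finite \<Rightarrow> real) \<Rightarrow> ('i \<Rightarrow> real^'J \<Rightarrow> real^'J)
     \<Rightarrow> real^'J \<Rightarrow> (real^'J) set" where
  "dcone I \<phi> \<gamma> x = (if x \<in> frontier (GG I \<phi>)
      then {(\<Sum>i\<in>Idx I \<phi> x. s i *\<^sub>R \<gamma> i x) | s. \<forall>i\<in>Idx I \<phi> x. 0 \<le> s i}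
      else {0})"

definition Uset :: "'i set \<Rightarrow> ('i \<Rightarrow> real^'J::finite \<Rightarrow> real) \<Rightarrow> ('i \<Rightarrow> real^'J \<Rightarrow> real^'J)
     \<Rightarrow> (real^'J) set" where
  "Uset I \<phi> \<gamma> = {x\<in>frontier (GG I \<phi>). \<exists>n\<in>ncone I \<phi> x.
      \<forall>d\<in>dcone I \<phi> \<gamma> x - {0}. inner n d > 0}"

definition pw_C1_refl :: "'i set \<Rightarrow> ('i \<Rightarrow> real^'J::finite \<Rightarrow> real) \<Rightarrow> ('i \<Rightarrow> real^'J \<Rightarrow> real^'J) \<Rightarrow> bool" where
  "pw_C1_refl I \<phi> \<gamma> \<longleftrightarrow> finite I \<and> GG I \<phi> \<noteq> {} \<and> open (GG I \<phi>) \<and> connected (GG I \<phi>)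
     \<and> (\<forall>i\<in>I. C1_fun (\<phi> i)
          \<and> frontier (Gi \<phi> i) = {x. \<phi> i x = 0}
          \<and> (\<forall>x\<in>frontier (Gi \<phi> i). grad (\<phi> i) x \<noteq> 0)
          \<and> continuous_on (frontier (Gi \<phi> i)) (\<gamma> i)
          \<and> (\<forall>x\<in>frontier (Gi \<phi> i). inner (nrm \<phi> i x) (\<gamma> i x) > 0))"

definition polyhedral_refl :: "'i set \<Rightarrow> ('i \<Rightarrow> real^'J::finite \<Rightarrow> real) \<Rightarrow> ('i \<Rightarrow> real^'J \<Rightarrow> real^'J) \<Rightarrow> bool" where
  "polyhedral_refl I \<phi> \<gamma> \<longleftrightarrow> pw_C1_refl I \<phi> \<gamma>
     \<and> (\<forall>i\<in>I. (\<exists>\<nu>. \<forall>x\<in>frontier (Gi \<phi> i). nrm \<phi> i x = \<nu>)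
             \<and> (\<exists>g. \<forall>x\<in>frontier (Gi \<phi> i). \<gamma> i x = g))"

definition Assumption2' :: "'i set \<Rightarrow> ('i \<Rightarrow> real^'J::finite \<Rightarrow> real) \<Rightarrow> ('i \<Rightarrow> real^'J \<Rightarrow> real^'J)
     \<Rightarrow> (real^'J \<Rightarrow> real^'N::finite^'J) \<Rightarrow> (real^'J) set \<Rightarrow> bool" where
  "Assumption2' I \<phi> \<gamma> \<sigma> V \<longleftrightarrow> finite V \<and> frontier (GG I \<phi>) - Uset I \<phi> \<gamma> \<subseteq> V \<and>
    (\<forall>x\<in>V. \<exists>v r \<alpha> c1 c2. norm v = 1 \<and> r > 0 \<and> \<alpha> > 0 \<and> 0 < c1 \<and> c1 < 1 \<and> 1 < c2 \<and>
       (\<forall>y\<in>closure (GG I \<phi>) \<inter> cball x r.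
           inner v (y - x) \<ge> \<alpha> * norm (y - x)
         \<and> Idx I \<phi> y \<subseteq> Idx I \<phi> x
         \<and> (\<forall>i\<in>Idx I \<phi> y. inner (\<gamma> i y) v \<ge> 0)) \<and>
       (\<forall>\<rho>. 0 < \<rho> \<and> \<rho> < r / c2 \<longrightarrow>
           closure (GG I \<phi>) \<inter> cball x (c1 * \<rho>)
             \<subseteq> {y\<in>closure (GG I \<phi>) \<inter> cball x r.
                   infdist y ((+) (x + \<rho> *\<^sub>R v) ` {z. inner z v \<ge> 0}) > 0}
         \<and> {y\<in>closure (GG I \<phi>) \<inter> cball x r.
                   infdist y ((+) (x + \<rho> *\<^sub>R v) ` {z. inner z v \<ge> 0}) > 0}
             \<subseteq> closure (GG I \<phi>) \<inter> cball x (c2 * \<rho>)) \<and>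
       (\<forall>y\<in>cball x r. inner v (amat \<sigma> y *v v) \<ge> \<alpha>))"

definition Hset :: "'i set \<Rightarrow> ('i \<Rightarrow> real^'J::finite \<Rightarrow> real) \<Rightarrow> ('i \<Rightarrow> real^'J \<Rightarrow> real^'J)
     \<Rightarrow> (real^'J) set \<Rightarrow> (real^'J \<Rightarrow> real) set" where
  "Hset I \<phi> \<gamma> V = {f. C2c_plus (closure (GG I \<phi>)) f
      \<and> (\<forall>x\<in>V. \<exists>\<delta>>0. \<exists>k. \<forall>y\<in>closure (GG I \<phi>) \<inter> ball x \<delta>. f y = k)
      \<and> (\<forall>y\<in>frontier (GG I \<phi>). \<forall>d\<in>dcone I \<phi> \<gamma> y. inner d (grad f y) \<le> 0)}"

definition AssumptionTF :: "(real^'J::finite \<Rightarrow> real^'J) \<Rightarrow> (real^'J \<Rightarrow> real^'N::finite^'J)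
     \<Rightarrow> 'i set \<Rightarrow> ('i \<Rightarrow> real^'J \<Rightarrow> real) \<Rightarrow> ('i \<Rightarrow> real^'J \<Rightarrow> real^'J) \<Rightarrow> (real^'J) set \<Rightarrow> bool" where
  "AssumptionTF b \<sigma> I \<phi> \<gamma> V \<longleftrightarrow>
    (\<forall>\<epsilon>>0. \<forall>N::nat. \<exists>(f :: real^'J \<Rightarrow> real^'J \<Rightarrow> real) C c. C > 0 \<and> c > 0 \<and>
      (\<forall>x\<in>closure (GG I \<phi>) \<inter> cball 0 (real N).
          C2b (closure (GG I \<phi>)) (f x)
        \<and> (\<forall>y\<in>closure (GG I \<phi>). f x y \<ge> 0)
        \<and> (\<exists>h :: nat \<Rightarrow> real^'J \<Rightarrow> real.
              (\<forall>k. h k \<in> Hset I \<phi> \<gamma> V \<and> C2c (closure (GG I \<phi>)) (h k))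
            \<and> (\<forall>y\<in>closure (GG I \<phi>). (\<lambda>k. h k y) sums f x y))
        \<and> (\<forall>y\<in>closure (GG I \<phi>). norm (y - x) \<le> \<epsilon> / 2 \<longrightarrow> f x y = 0)
        \<and> (\<forall>y\<in>closure (GG I \<phi>). norm (y - x) > 3 * \<epsilon> \<longrightarrow> f x y > c)
        \<and> (\<forall>y\<in>closure (GG I \<phi>). \<bar>Lgen b \<sigma> (f x) y\<bar> \<le> C)))"

definition AssumptionV :: "(real^'J::finite \<Rightarrow> real^'N::finite^'J)
     \<Rightarrow> 'i set \<Rightarrow> ('i \<Rightarrow> real^'J \<Rightarrow> real) \<Rightarrow> ('i \<Rightarrow> real^'J \<Rightarrow> real^'J) \<Rightarrow> (real^'J) set \<Rightarrow> bool" where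
  "AssumptionV \<sigma> I \<phi> \<gamma> V \<longleftrightarrow> finite V \<and>
    (\<forall>x\<in>V. \<exists>v \<alpha> r. norm v = 1 \<and> \<alpha> > 0 \<and> r > 0 \<and>
       (\<forall>y\<in>closure (GG I \<phi>) \<inter> cball x r.
           inner v (y - x) \<ge> \<alpha> * norm (y - x)
         \<and> inner v (amat \<sigma> y *v v) \<ge> \<alpha>
         \<and> (\<forall>d\<in>dcone I \<phi> \<gamma> y. inner v d \<ge> 0)))"

end

theory Submission
  imports Defs
begin

text \<open>
  Near a point \<open>z\<close> of the closed domain, composing a decreasing cutoff with the barrier
  \<open>w \<mapsto> \<langle>n, w\<rangle> + \<kappa> |w|\<^sup>2\<close>, \<open>w = y - z\<close>, gives a bump that decreases along the reflection directions.
  For \<open>z \<in> V\<close> take \<open>\<kappa> = 0\<close> and \<open>n\<close> a multiple of \<open>v_z\<close>; otherwise \<open>n\<close> is a large multiple of the normal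
  furnished by \<open>z \<in> U\<close>, and the quadratic term makes the barrier large on a small sphere about \<open>z\<close>.
  The test function \<open>f_{x,\<epsilon>}\<close> is the sum of the bumps, centred at grid-selected points, that stay away from \<open>x\<close>.

  This needs bumps of uniform size. If there were none, some sequence of points would need ever
  smaller bumps. A bounded sequence accumulates at a point, whose bump serves all nearby points. In an unbounded
  polyhedral domain one passes to a subsequence along which each slack \<open>\<langle>\<nu>_i, y\<rangle> - \<beta>_i\<close> converges or tends to
  infinity; a vanishing correction makes the convergent slacks constant, so the corrected points all have the same
  active constraints and translates of a single bump work for all of them.
\<close>

section \<open>Twice continuously differentiable functions\<close>

lemma pd_eq:
  assumes "(f has_derivative f') (at x)"
  shows "pd i f x = f' (axis i 1)"
  using frechet_derivative_at[OF assms] by (simp add: pd_def)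

text \<open>\<open>frechet_derivative\<close> is a choice from the set of derivatives at the point,
  and this set depends only on the function near the point. The identity therefore also covers
  points where no derivative exists.\<close>

lemma pd_cong_open:
  assumes "open U" "x \<in> U" "\<And>y. y \<in> U \<Longrightarrow> f y = g y"
  shows "pd i f x = pd i g x"
proof -
  have "(f has_derivative f') (at x) \<longleftrightarrow> (g has_derivative f') (at x)" for f'
    using has_derivative_transform_within_open[of f f' x UNIV U g]
      has_derivative_transform_within_open[of g f' x UNIV U f] assms by auto
  then show ?thesis
    by (simp add: pd_def frechet_derivative_def)
qed

lemma differentiable_cong_open:
  assumes "open U" "x \<in> U" "\<And>y. y \<in> U \<Longrightarrow> f y = g y" "g differentiable (at x)"
  shows "f differentiable (at x)"
  using assms has_derivative_transform_within_open[of g _ x UNIV U f]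
  unfolding differentiable_def by metis

lemma inner_grad:
  assumes "(f has_derivative f') (at x)"
  shows "inner d (grad f x) = f' d"
proof -
  interpret linear f' using assms has_derivative_linear by blast
  have "f' d = f' (\<Sum>i\<in>UNIV. (d $ i) *\<^sub>R axis i 1)"
    by (metis basis_expansion scalar_mult_eq_scaleR)
  also have "\<dots> = (\<Sum>i\<in>UNIV. d $ i * f' (axis i 1))"
    by (simp add: sum scale)
  finally show ?thesis
    by (simp add: inner_vec_def grad_def pd_eq[OF assms])
qed

lemma C2_on_UNIV_iff:
  "C2_on UNIV f \<longleftrightarrow> (\<forall>x. f differentiable (at x)) \<and> (\<forall>j x. pd j f differentiable (at x))
     \<and> (\<forall>i j. continuous_on UNIV (pd i (pd j f)))"
  by (simp add: C2_on_def)

lemma C2_D: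
  assumes "C2_on UNIV f"
  shows "f differentiable (at x)" "pd j f differentiable (at x)"
    "continuous_on UNIV (pd i (pd j f))" "continuous_on UNIV (pd j f)" "continuous_on UNIV f"
proof -
  show "f differentiable (at x)" "pd j f differentiable (at x)"
    "continuous_on UNIV (pd i (pd j f))"
    using assms by (auto simp: C2_on_UNIV_iff)
  show "continuous_on UNIV (pd j f)" "continuous_on UNIV f"
    using assms differentiable_imp_continuous_within
    unfolding C2_on_UNIV_iff continuous_on_eq_continuous_within by blast+
qed

text \<open>The local model \<open>g\<close> may change with the point. This lets an infinite but
  locally finite sum inherit smoothness from its finite partial sums.\<close>

lemma C2_on_UNIV_local:
  assumes "\<And>x. \<exists>U g. open U \<and> x \<in> U \<and> C2_on UNIV g \<and> (\<forall>y\<in>U. f y = g y)"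
  shows "C2_on UNIV f"
  unfolding C2_on_UNIV_iff
proof (intro conjI allI)
  fix x i j
  obtain U g where U: "open U" "x \<in> U" and g: "C2_on UNIV g" and eq: "\<And>y. y \<in> U \<Longrightarrow> f y = g y"
    using assms by metis
  have eq1: "pd j f y = pd j g y" if "y \<in> U" for y j
    by (rule pd_cong_open[OF U(1) that eq])
  show "f differentiable (at x)"
    by (rule differentiable_cong_open[OF U eq C2_D(1)[OF g]])
  show "pd j f differentiable (at x)"
    by (rule differentiable_cong_open[OF U eq1 C2_D(2)[OF g]])
next
  fix i j
  have "isCont (pd i (pd j f)) x" for x
  proof -
    obtain U g where U: "open U" "x \<in> U" and g: "C2_on UNIV g" and eq: "\<And>y. y \<in> U \<Longrightarrow> f y = g y"
      using assms by metis
    have eq1: "pd j f y = pd j g y" if "y \<in> U" for y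
      by (rule pd_cong_open[OF U(1) that eq])
    have "pd i (pd j f) y = pd i (pd j g) y" if "y \<in> U" for y
      by (rule pd_cong_open[OF U(1) that eq1])
    moreover have "isCont (pd i (pd j g)) x"
      using C2_D(3)[OF g] by (simp add: continuous_on_eq_continuous_within)
    ultimately show ?thesis
      using isCont_cong[of "pd i (pd j f)" "pd i (pd j g)" x] U eventually_nhds by blast
  qed
  then show "continuous_on UNIV (pd i (pd j f))"
    by (simp add: continuous_on_eq_continuous_within)
qed

lemma pd_const: "pd i (\<lambda>_. c) = (\<lambda>_. 0)"
  by (rule ext, subst pd_eq[where f' = "\<lambda>_. 0"]) auto

lemma C2_const: "C2_on UNIV (\<lambda>_. c)"
  by (simp add: C2_on_UNIV_iff pd_const)

lemma pd_add:
  assumes "f differentiable (at x)" "g differentiable (at x)"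
  shows "pd i (\<lambda>y. f y + g y) x = pd i f x + pd i g x"
  using pd_eq[OF has_derivative_add[OF assms[unfolded frechet_derivative_works]]]
  by (simp add: pd_def)

lemma pd_mult:
  assumes "f differentiable (at x)" "g differentiable (at x)"
  shows "pd i (\<lambda>y. f y * g y) x = pd i f x * g x + f x * pd i g x"
  using pd_eq[OF has_derivative_mult[OF assms[unfolded frechet_derivative_works]]]
  by (simp add: pd_def)

lemma C2_add:
  assumes f: "C2_on UNIV f" and g: "C2_on UNIV g"
  shows "C2_on UNIV (\<lambda>y. f y + g y)"
proof -
  have 1: "pd j (\<lambda>y. f y + g y) = (\<lambda>y. pd j f y + pd j g y)" for j
    using C2_D[OF f] C2_D[OF g] by (auto simp: pd_add)
  have 2: "pd i (\<lambda>y. pd j f y + pd j g y) = (\<lambda>y. pd i (pd j f) y + pd i (pd j g) y)" for i j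
    using C2_D[OF f] C2_D[OF g] by (auto simp: pd_add)
  show ?thesis
    unfolding C2_on_UNIV_iff 1 2
    using C2_D[OF f] C2_D[OF g] by (auto intro!: continuous_on_add differentiable_add)
qed

lemma C2_mult:
  assumes f: "C2_on UNIV f" and g: "C2_on UNIV g"
  shows "C2_on UNIV (\<lambda>y. f y * g y)"
proof -
  have 1: "pd j (\<lambda>y. f y * g y) = (\<lambda>y. pd j f y * g y + f y * pd j g y)" for j
    using C2_D[OF f] C2_D[OF g] by (auto simp: pd_mult)
  have 2: "pd i (\<lambda>y. pd j f y * g y + f y * pd j g y) =
     (\<lambda>y. (pd i (pd j f) y * g y + pd j f y * pd i g y)
        + (pd i f y * pd j g y + f y * pd i (pd j g) y))" for i j
    using C2_D[OF f] C2_D[OF g] by (auto simp: pd_mult pd_add)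
  show ?thesis
    unfolding C2_on_UNIV_iff 1 2
    using C2_D[OF f] C2_D[OF g]
    by (auto intro!: continuous_on_add continuous_on_mult differentiable_add differentiable_mult)
qed

lemma C2_sum:
  assumes "finite S" "\<And>k. k \<in> S \<Longrightarrow> C2_on UNIV (h k)"
  shows "C2_on UNIV (\<lambda>y. \<Sum>k\<in>S. h k y)"
  using assms by (induction S rule: finite_induct) (auto simp: C2_const intro: C2_add)

lemma pd_sum:
  assumes "finite S" "\<And>k. k \<in> S \<Longrightarrow> h k differentiable (at x)"
  shows "pd i (\<lambda>y. \<Sum>k\<in>S. h k y) x = (\<Sum>k\<in>S. pd i (h k) x)"
  using assms
  by (induction S rule: finite_induct) (auto simp: pd_const pd_add)

text \<open>Carrying \<open>p'\<close> and \<open>p''\<close> explicitly gives closed formulas for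
  the partials of both orders, from which continuity can be read off.\<close>

lemma C2_compose_real:
  fixes p p' p'' :: "real \<Rightarrow> real"
  assumes p: "\<And>s. (p has_real_derivative p' s) (at s)"
    and p': "\<And>s. (p' has_real_derivative p'' s) (at s)" and p'': "continuous_on UNIV p''"
    and f: "C2_on UNIV f"
  shows "C2_on UNIV (\<lambda>y. p (f y))"
proof -
  have D: "((\<lambda>y. q (f y)) has_derivative (\<lambda>h. q' (f x) * frechet_derivative f (at x) h)) (at x)"
    if "\<And>s. (q has_real_derivative q' s) (at s)" for q q' x
    using has_derivative_compose[OF C2_D(1)[OF f, unfolded frechet_derivative_works]
        that[unfolded has_field_derivative_def]] .
  have P: "pd i (\<lambda>y. q (f y)) x = q' (f x) * pd i f x"
    if "\<And>s. (q has_real_derivative q' s) (at s)" for q q' x i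
    using pd_eq[OF D[OF that]] by (simp add: pd_def)
  have diff: "(\<lambda>y. q (f y)) differentiable (at x)"
    if "\<And>s. (q has_real_derivative q' s) (at s)" for q q' x
    using D[OF that] differentiable_def by blast
  have 1: "pd j (\<lambda>y. p (f y)) = (\<lambda>y. p' (f y) * pd j f y)" for j
    using P[OF p] by auto
  have 2: "pd i (\<lambda>y. p' (f y) * pd j f y) =
     (\<lambda>y. (p'' (f y) * pd i f y) * pd j f y + p' (f y) * pd i (pd j f) y)" for i j
    using C2_D[OF f] by (auto simp: pd_mult[OF diff[OF p']] P[OF p'])
  have c: "continuous_on UNIV (\<lambda>y. p'' (f y))"
    using continuous_on_compose2[OF p'' C2_D(5)[OF f]] by auto
  have c': "continuous_on UNIV (\<lambda>y. p' (f y))"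
    using diff[OF p'] differentiable_imp_continuous_within
    by (auto simp: continuous_on_eq_continuous_within)
  show ?thesis
    unfolding C2_on_UNIV_iff 1 2
    using C2_D[OF f] diff[OF p] diff[OF p'] c c'
    by (auto intro!: continuous_on_add continuous_on_mult differentiable_mult)
qed

lemma C2_inner: "C2_on UNIV (\<lambda>y. inner n y)"
proof -
  have "((\<lambda>y. inner n y) has_derivative (\<lambda>h. inner n h)) (at x)" for x
    by (auto intro!: derivative_eq_intros)
  then have "pd i (\<lambda>y. inner n y) = (\<lambda>_. inner n (axis i 1))" "(\<lambda>y. inner n y) differentiable (at x)" for i x
    using pd_eq unfolding differentiable_def by blast+
  then show ?thesis
    by (simp add: C2_on_UNIV_iff pd_const)
qed

lemma C2_norm_square: "C2_on UNIV (\<lambda>y::real^'J::finite. (norm y)\<^sup>2)"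
proof -
  have eq: "(norm y)\<^sup>2 = (\<Sum>i\<in>UNIV. inner (axis i 1) y * inner (axis i 1) y)" for y :: "real^'J"
    unfolding power2_norm_eq_inner inner_axis' by (simp add: inner_vec_def)
  show ?thesis
    unfolding eq by (intro C2_sum C2_mult C2_inner) auto
qed

text \<open>Translation preserves the whole set of derivatives, so \<open>f\<close> may be
  arbitrary; applying the identity again to \<open>pd j f\<close> yields second partials.\<close>

lemma pd_translate: "pd i (\<lambda>y. f (y - z)) x = pd i f (x - z)"
proof -
  have "((\<lambda>y. f (y - z)) has_derivative f') (at x) \<longleftrightarrow> (f has_derivative f') (at (x - z))" for f'
  proof
    assume "(f has_derivative f') (at (x - z))"
    then show "((\<lambda>y. f (y - z)) has_derivative f') (at x)"
      using has_derivative_compose[OF has_derivative_diff[OF has_derivative_ident has_derivative_const], of f f' x z]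
      by simp
  next
    assume "((\<lambda>y. f (y - z)) has_derivative f') (at x)"
    then show "(f has_derivative f') (at (x - z))"
      using has_derivative_compose[OF has_derivative_add[OF has_derivative_ident has_derivative_const],
          of "\<lambda>y. f (y - z)" f' "x - z" z] by simp
  qed
  then show ?thesis
    by (simp add: pd_def frechet_derivative_def)
qed

lemma C2_translate:
  assumes f: "C2_on UNIV f"
  shows "C2_on UNIV (\<lambda>y. f (y - z))"
proof -
  have d: "(\<lambda>y. g (y - z)) differentiable (at x)" if "\<And>x. g differentiable (at x)"
    for g :: "real^'a \<Rightarrow> real" and x
    using that[of "x - z"] has_derivative_compose[OF has_derivative_diff[OF has_derivative_ident has_derivative_const], of g _ x z]
    unfolding differentiable_def by auto
  have 1: "pd j (\<lambda>y. f (y - z)) = (\<lambda>y. pd j f (y - z))" for j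
    using pd_translate by blast
  have 2: "pd i (\<lambda>y. pd j f (y - z)) = (\<lambda>y. pd i (pd j f) (y - z))" for i j
    using pd_translate by blast
  have 3: "continuous_on UNIV (\<lambda>y. pd i (pd j f) (y - z))" for i j
    by (rule continuous_on_compose2[OF C2_D(3)[OF f]]) (auto intro: continuous_intros)
  show ?thesis
    unfolding C2_on_UNIV_iff 1 2
    using d[OF C2_D(1)[OF f]] d[OF C2_D(2)[OF f]] 3 by blast
qed

section \<open>Cutoff functions and the bump profile\<close>

text \<open>The exponent is at least two, so the difference quotient at the kink 0 is dominated by a
  positive power of \<open>\<bar>h\<bar>\<close>. The cases \<open>n = 1\<close> and
  \<open>n = 0\<close> differentiate a truncated cube twice.\<close>

lemma max_power_has_real_derivative:
  "((\<lambda>s::real. max 0 s ^ Suc (Suc n)) has_real_derivative real (Suc (Suc n)) * max 0 s ^ Suc n) (at s)"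
proof -
  consider "s > 0" | "s < 0" | "s = 0" by linarith
  then show ?thesis
  proof cases
    case 1
    have "((\<lambda>s::real. s ^ Suc (Suc n)) has_real_derivative real (Suc (Suc n)) * max 0 s ^ Suc n) (at s)"
      using DERIV_pow[of "Suc (Suc n)" s] 1 by (simp add: max_def)
    then show ?thesis
      by (rule has_field_derivative_transform_within_open[where S = "{0<..}"]) (use 1 in auto)
  next
    case 2
    have "((\<lambda>s::real. 0) has_real_derivative real (Suc (Suc n)) * max 0 s ^ Suc n) (at s)"
      using 2 by (auto intro!: derivative_eq_intros simp: max_def)
    then show ?thesis
      by (rule has_field_derivative_transform_within_open[where S = "{..<0}"]) (use 2 in auto)
  next
    case 3
    have lim: "((\<lambda>h::real. \<bar>h\<bar> ^ Suc n) \<longlongrightarrow> 0) (at 0)"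
      by (auto intro!: tendsto_eq_intros)
    have "((\<lambda>h::real. max 0 h ^ Suc (Suc n) / h) \<longlongrightarrow> 0) (at 0)"
      by (rule tendsto_rabs_zero_cancel, rule tendsto_sandwich[OF _ _ tendsto_const lim])
         (auto intro!: always_eventually simp: max_def abs_mult power_abs mult_nonpos_nonneg)
    then show ?thesis
      using 3 by (simp add: DERIV_def)
  qed
qed

text \<open>With \<open>p s = max 0 s ^ 3\<close>, the function \<open>1 - p (s - 1)\<close> is 1 up
  to \<open>s = 1\<close>, then decreases, and is nonpositive from \<open>s = 2\<close> on. Applying
  \<open>p\<close> once more truncates it at 0, and cubes keep the second derivative
  continuous.\<close>

lemma C2_cutoff_exists:
  obtains \<psi> \<psi>' \<psi>'' :: "real \<Rightarrow> real"
  where "\<And>s. (\<psi> has_real_derivative \<psi>' s) (at s)" "\<And>s. (\<psi>' has_real_derivative \<psi>'' s) (at s)"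
    "continuous_on UNIV \<psi>''" "\<And>s. 0 \<le> \<psi> s" "\<And>s. \<psi> s \<le> 1"
    "\<And>s. s \<le> 1 \<Longrightarrow> \<psi> s = 1" "\<And>s. s \<le> 1 \<Longrightarrow> \<psi>' s = 0" "\<And>s. 2 \<le> s \<Longrightarrow> \<psi> s = 0" "\<And>s. \<psi>' s \<le> 0"
proof -
  define p p' p'' :: "real \<Rightarrow> real" where "p = (\<lambda>s. max 0 s ^ 3)"
    and "p' = (\<lambda>s. 3 * max 0 s ^ 2)" and "p'' = (\<lambda>s. 6 * max 0 s)"
  have p: "(p has_real_derivative p' s) (at s)" for s
    using max_power_has_real_derivative[of 1 s] by (simp add: p_def p'_def numeral_eq_Suc)
  have p': "(p' has_real_derivative p'' s) (at s)" for s
    using DERIV_cmult[OF max_power_has_real_derivative[of 0 s], of 3]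
    by (simp add: p'_def p''_def numeral_eq_Suc)
  have d1: "((\<lambda>s. s - 1) has_real_derivative 1) (at s)" for s :: real
    by (auto intro!: derivative_eq_intros)
  have p1: "((\<lambda>s. p (s - 1)) has_real_derivative p' (s - 1)) (at s)" for s
    using DERIV_chain2[OF p d1] by simp
  have p'1: "((\<lambda>s. p' (s - 1)) has_real_derivative p'' (s - 1)) (at s)" for s
    using DERIV_chain2[OF p' d1] by simp
  have q: "((\<lambda>s. 1 - p (s - 1)) has_real_derivative - p' (s - 1)) (at s)" for s
    using DERIV_diff[OF DERIV_const p1, of 1 s] by simp
  let ?f = "\<lambda>s. p (1 - p (s - 1))"
  let ?f' = "\<lambda>s. p' (1 - p (s - 1)) * - p' (s - 1)"
  let ?f'' = "\<lambda>s. p'' (1 - p (s - 1)) * - p' (s - 1) * - p' (s - 1) + - p'' (s - 1) * p' (1 - p (s - 1))"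
  show ?thesis
  proof (rule that[of ?f ?f' ?f''])
    show "(?f has_real_derivative ?f' s) (at s)" for s
      using DERIV_chain2[OF p q] by simp
    show "(?f' has_real_derivative ?f'' s) (at s)" for s
      using DERIV_mult[OF DERIV_chain2[OF p' q] DERIV_minus[OF p'1]] by simp
    show "continuous_on UNIV ?f''"
      unfolding p_def p'_def p''_def by (intro continuous_intros)
    show "?f s \<le> 1" for s
      unfolding p_def by (intro power_le_one) auto
    show "?f s = 0" if "2 \<le> s" for s
      using that one_le_power[of "s - 1" 3] by (simp add: p_def max_def del: one_le_power)
  qed (auto simp: p_def p'_def)
qed

lemma bounded_if_continuous_compact_support:
  fixes g :: "'a::euclidean_space \<Rightarrow> real"
  assumes "continuous_on UNIV g" "\<And>w. \<rho> < norm w \<Longrightarrow> g w = 0"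
  shows "\<exists>B>0. \<forall>w. \<bar>g w\<bar> \<le> B"
proof -
  have "compact (g ` cball 0 \<rho>)"
    using assms(1) by (intro compact_continuous_image) (auto intro: continuous_on_subset)
  then obtain B where B: "B > 0" "\<forall>x\<in>g ` cball 0 \<rho>. norm x \<le> B"
    using compact_imp_bounded bounded_pos by blast
  have "\<bar>g w\<bar> \<le> B" for w
  proof (cases "norm w \<le> \<rho>")
    case True
    then show ?thesis using B(2) by auto
  next
    case False
    then show ?thesis using B(1) assms(2)[of w] by auto
  qed
  then show ?thesis using B(1) by blast
qed

text \<open>The bump is \<open>\<psi> (\<langle>n, w\<rangle> + \<kappa> |w|\<^sup>2)\<close> times a radial cutoff; where the cutoff is not locally constant
  the hypothesis on the shell makes the first factor vanish.\<close>

lemma barrier_bump_exists: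
  fixes n :: "real^'J::finite"
  assumes \<rho>: "\<rho> > 0"
  shows "\<exists>T r. r > 0 \<and> C2_on UNIV T \<and> (\<forall>w. 0 \<le> T w) \<and> (\<forall>w. T w \<le> 1) \<and>
    (\<forall>w. \<rho> \<le> norm w \<longrightarrow> T w = 0) \<and> (\<forall>w. norm w < r \<longrightarrow> T w = 1) \<and>
    (\<forall>i w. \<bar>pd i T w\<bar> \<le> 1 / r) \<and> (\<forall>i j w. \<bar>pd i (pd j T) w\<bar> \<le> 1 / r) \<and>
    (\<forall>w d. (norm w \<le> \<rho> \<longrightarrow> 0 \<le> inner d (n + (2 * \<kappa>) *\<^sub>R w)) \<longrightarrow>
       (\<rho> / 2 \<le> norm w \<longrightarrow> norm w \<le> \<rho> \<longrightarrow> 2 \<le> inner n w + \<kappa> * (norm w)\<^sup>2) \<longrightarrow>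
       inner d (grad T w) \<le> 0)"
proof -
  obtain \<psi> \<psi>' \<psi>'' :: "real \<Rightarrow> real" where
    \<psi>: "\<And>s. (\<psi> has_real_derivative \<psi>' s) (at s)" "\<And>s. (\<psi>' has_real_derivative \<psi>'' s) (at s)"
      "continuous_on UNIV \<psi>''"
    and \<psi>0: "\<And>s. 0 \<le> \<psi> s" "\<And>s. \<psi> s \<le> 1" "\<And>s. s \<le> 1 \<Longrightarrow> \<psi> s = 1" "\<And>s. s \<le> 1 \<Longrightarrow> \<psi>' s = 0"
      "\<And>s. 2 \<le> s \<Longrightarrow> \<psi> s = 0" "\<And>s. \<psi>' s \<le> 0"
    by (rule C2_cutoff_exists) blast
  define s where "s = (\<lambda>w. inner n w + \<kappa> * (norm w)\<^sup>2)"
  \<comment> \<open>The factor makes \<open>q\<close> equal 1 on the sphere of radius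
    \<open>\<rho> / 2\<close> and 4 on the sphere of radius \<open>\<rho>\<close>, so
    \<open>\<psi> (q w)\<close> is 1 within the former and 0 beyond the latter.\<close>
  define q where "q = (\<lambda>w::real^'J. 4 / \<rho>\<^sup>2 * (norm w)\<^sup>2)"
  define T where "T = (\<lambda>w. \<psi> (s w) * \<psi> (q w))"
  have sC2: "C2_on UNIV s"
    unfolding s_def by (intro C2_add C2_mult C2_inner C2_norm_square C2_const)
  have qC2: "C2_on UNIV q"
    unfolding q_def by (intro C2_mult C2_norm_square C2_const)
  have TC2: "C2_on UNIV T"
    unfolding T_def by (intro C2_mult C2_compose_real[OF \<psi>] sC2 qC2)
  have q1: "q w \<le> 1" if "norm w \<le> \<rho> / 2" for w
    using power_mono[OF that, of 2] \<rho> by (simp add: q_def field_simps)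
  have q2: "2 \<le> q w" if "\<rho> \<le> norm w" for w
  proof -
    have "\<rho>\<^sup>2 \<le> (norm w)\<^sup>2" using that \<rho> by (intro power_mono) auto
    then have "4 \<le> q w" using \<rho> by (simp add: q_def field_simps)
    then show ?thesis by simp
  qed
  have T0: "T w = 0" if "\<rho> \<le> norm w" for w
    using \<psi>0(5)[OF q2[OF that]] by (simp add: T_def)
  have "isCont s 0" "isCont q 0"
    using C2_D(5)[OF sC2] C2_D(5)[OF qC2] by (auto simp: continuous_on_eq_continuous_within)
  moreover have "s 0 = 0" "q 0 = 0" by (auto simp: s_def q_def)
  ultimately obtain r1 r2 where r12: "r1 > 0" "\<And>w. dist w 0 < r1 \<Longrightarrow> dist (s w) 0 < 1"
      "r2 > 0" "\<And>w. dist w 0 < r2 \<Longrightarrow> dist (q w) 0 < 1"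
    unfolding continuous_at_eps_delta by (metis zero_less_one)
  have T1: "T w = 1" if "norm w < min r1 r2" for w
  proof -
    have "s w \<le> 1" "q w \<le> 1"
      using r12(2)[of w] r12(4)[of w] that by (auto simp: dist_norm)
    then show ?thesis using \<psi>0(3) by (simp add: T_def)
  qed
  have out: "open {w::real^'J. \<rho> < norm w}"
    by (intro open_Collect_less continuous_intros)
  have pd0: "pd j T w = 0" if "\<rho> < norm w" for w j
    using pd_cong_open[OF out, of w T "\<lambda>_. 0" j] that T0 by (simp add: pd_const)
  have pdd0: "pd i (pd j T) w = 0" if "\<rho> < norm w" for w i j
    using pd_cong_open[OF out, of w "pd j T" "\<lambda>_. 0" i] that pd0 by (simp add: pd_const)
  have "\<exists>B>0. \<forall>w. \<bar>pd j T w\<bar> \<le> B" for j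
    by (rule bounded_if_continuous_compact_support[OF C2_D(4)[OF TC2] pd0])
  then obtain B where B: "\<And>j. B j > 0" "\<And>j w. \<bar>pd j T w\<bar> \<le> B j" by metis
  have "\<exists>B>0. \<forall>w. \<bar>pd i (pd j T) w\<bar> \<le> B" for i j
    by (rule bounded_if_continuous_compact_support[OF C2_D(3)[OF TC2] pdd0])
  then obtain E where E: "\<And>i j. E i j > 0" "\<And>i j w. \<bar>pd i (pd j T) w\<bar> \<le> E i j" by metis
  define D where "D = 1 + (\<Sum>j\<in>UNIV. B j) + (\<Sum>j\<in>UNIV. \<Sum>i\<in>UNIV. E i j)"
  have B0: "0 \<le> B j" and E0: "0 \<le> E i j" for i j
    using B(1)[of j] E(1)[of i j] by auto
  have Bn: "0 \<le> (\<Sum>j\<in>UNIV. B j)" and En: "0 \<le> (\<Sum>j\<in>UNIV. \<Sum>i\<in>UNIV. E i j)"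
    using B0 E0 by (auto intro!: sum_nonneg)
  have BD: "B j \<le> D" for j
    using member_le_sum[of j UNIV B] B0 En by (auto simp: D_def)
  have ED: "E i j \<le> D" for i j
  proof -
    have "E i j \<le> (\<Sum>i\<in>UNIV. E i j)"
      using member_le_sum[of i UNIV "\<lambda>i. E i j"] E0 by auto
    also have "\<dots> \<le> (\<Sum>j\<in>UNIV. \<Sum>i\<in>UNIV. E i j)"
      using member_le_sum[of j UNIV "\<lambda>j. \<Sum>i\<in>UNIV. E i j"] E0
      by (auto intro!: sum_nonneg)
    finally show ?thesis using Bn by (simp add: D_def)
  qed
  have D: "D > 0" using Bn En by (simp add: D_def)
  \<comment> \<open>One number serves as plateau radius and, through \<open>1 / r\<close>, as
    derivative bound. Shrinking it weakens both demands, so the minimum may be taken.\<close>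
  define r where "r = min (min r1 r2) (1 / D)"
  have r: "r > 0" using D r12 by (simp add: r_def)
  have "r \<le> 1 / D" by (simp add: r_def)
  then have Dr: "D \<le> 1 / r" using D r by (simp add: field_simps)
  show ?thesis
  proof (rule exI[of _ T], rule exI[of _ r], intro conjI r TC2)
    show "\<forall>w. 0 \<le> T w" "\<forall>w. T w \<le> 1"
      using \<psi>0(1,2) by (auto simp: T_def mult_le_one)
    show "\<forall>w. \<rho> \<le> norm w \<longrightarrow> T w = 0" using T0 by blast
    show "\<forall>w. norm w < r \<longrightarrow> T w = 1" using T1 by (simp add: r_def)
    show "\<forall>i w. \<bar>pd i T w\<bar> \<le> 1 / r"
      using order_trans[OF B(2) order_trans[OF BD Dr]] by blast
    show "\<forall>i j w. \<bar>pd i (pd j T) w\<bar> \<le> 1 / r"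
      using order_trans[OF E(2) order_trans[OF ED Dr]] by blast
    show "\<forall>w d. (norm w \<le> \<rho> \<longrightarrow> 0 \<le> inner d (n + (2 * \<kappa>) *\<^sub>R w)) \<longrightarrow>
         (\<rho> / 2 \<le> norm w \<longrightarrow> norm w \<le> \<rho> \<longrightarrow> 2 \<le> inner n w + \<kappa> * (norm w)\<^sup>2) \<longrightarrow>
         inner d (grad T w) \<le> 0"
    proof (intro allI impI)
      fix w d
      assume d: "norm w \<le> \<rho> \<longrightarrow> 0 \<le> inner d (n + (2 * \<kappa>) *\<^sub>R w)"
        and sh: "\<rho> / 2 \<le> norm w \<longrightarrow> norm w \<le> \<rho> \<longrightarrow> 2 \<le> inner n w + \<kappa> * (norm w)\<^sup>2"
      have N: "((\<lambda>w. (norm w)\<^sup>2) has_derivative (\<lambda>h. 2 * inner w h)) (at w)"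
        unfolding power2_norm_eq_inner
        by (auto intro!: derivative_eq_intros simp: inner_commute)
      have S: "(s has_derivative (\<lambda>h. inner n h + \<kappa> * (2 * inner w h))) (at w)"
        unfolding s_def
        by (intro has_derivative_add has_derivative_mult_right N has_derivative_inner_right
            has_derivative_ident)
      have Q: "(q has_derivative (\<lambda>h. 4 / \<rho>\<^sup>2 * (2 * inner w h))) (at w)"
        unfolding q_def by (intro has_derivative_mult_right N)
      note C = has_derivative_compose[OF _ \<psi>(1)[unfolded has_field_derivative_def]]
      have "inner d (grad T w) = \<psi> (s w) * (\<psi>' (q w) * (4 / \<rho>\<^sup>2 * (2 * inner w d)))
          + \<psi>' (s w) * (inner n d + \<kappa> * (2 * inner w d)) * \<psi> (q w)"
        unfolding T_def by (rule inner_grad[OF has_derivative_mult[OF C[OF S] C[OF Q]]])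
      also have "\<psi> (s w) * (\<psi>' (q w) * (4 / \<rho>\<^sup>2 * (2 * inner w d))) + \<psi>' (s w) * (inner n d + \<kappa> * (2 * inner w d)) * \<psi> (q w) \<le> 0"
      proof (cases "norm w \<le> \<rho>")
        case True
        have "\<psi> (s w) * \<psi>' (q w) = 0"
          using q1[of w] \<psi>0(4)[of "q w"] \<psi>0(5)[of "s w"] sh True by (force simp: s_def)
        then have "\<psi> (s w) * (\<psi>' (q w) * (4 / \<rho>\<^sup>2 * (2 * inner w d))) = 0"
          by auto
        moreover have "\<psi>' (s w) * (inner n d + \<kappa> * (2 * inner w d)) \<le> 0"
          using d True \<psi>0(6)
          by (intro mult_nonpos_nonneg) (auto simp: inner_add_right inner_commute algebra_simps)
        then have "\<psi>' (s w) * (inner n d + \<kappa> * (2 * inner w d)) * \<psi> (q w) \<le> 0"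
          using \<psi>0(1) by (rule mult_nonpos_nonneg)
        ultimately show ?thesis by linarith
      next
        case False
        \<comment> \<open>Beyond radius \<open>\<rho>\<close> nothing is known about
          \<open>d\<close>, but \<open>T\<close> vanishes near \<open>w\<close>; the displayed
          expression equals \<open>inner d (grad T w)\<close> and hence is 0.\<close>
        have "grad T w = 0"
          using pd0 False by (simp add: grad_def vec_eq_iff)
        then have "inner d (grad T w) = 0" by simp
        then show ?thesis using calculation by linarith
      qed
      finally show "inner d (grad T w) \<le> 0" .
    qed
  qed
qed

section \<open>Locally finite sums, generator bounds and grids\<close>

text \<open>On the unit ball about \<open>y0\<close> only the indices with centre within
  \<open>e + 1\<close> of \<open>y0\<close> can contribute, so there the series is one fixed finite
  sum with at most \<open>M\<close> terms. The additional 1 in the radius provides this common index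
  set, which differentiation requires.\<close>

lemma locally_finite_C2_sum:
  fixes h :: "nat \<Rightarrow> real^'J::finite \<Rightarrow> real"
  assumes C2: "\<And>k. k \<in> A \<Longrightarrow> C2_on UNIV (h k)"
    and supp: "\<And>k y. k \<in> A \<Longrightarrow> h k y \<noteq> 0 \<Longrightarrow> dist (z k) y \<le> e"
    and fin: "\<And>y. finite {k\<in>A. dist (z k) y \<le> e + 1}"
    and card: "\<And>y. card {k\<in>A. dist (z k) y \<le> e + 1} \<le> M"
    and D: "\<And>k y. k \<in> A \<Longrightarrow> \<bar>h k y\<bar> \<le> D" "\<And>k i y. k \<in> A \<Longrightarrow> \<bar>pd i (h k) y\<bar> \<le> D"
      "\<And>k i j y. k \<in> A \<Longrightarrow> \<bar>pd i (pd j (h k)) y\<bar> \<le> D" "0 \<le> D"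
  defines "F \<equiv> \<lambda>y. \<Sum>k. if k \<in> A then h k y else 0"
  shows "C2_on UNIV F" "\<bar>F y\<bar> \<le> M * D" "\<bar>pd i F y\<bar> \<le> M * D" "\<bar>pd i (pd j F) y\<bar> \<le> M * D"
    "(\<lambda>k. if k \<in> A then h k y else 0) sums F y"
proof -
  define S where "S y = {k\<in>A. dist (z k) y \<le> e + 1}" for y
  have S: "finite (S y)" "card (S y) \<le> M" "S y \<subseteq> A" for y
    using fin card by (auto simp: S_def)
  have sums: "(\<lambda>k. if k \<in> A then h k y else 0) sums (\<Sum>k\<in>S y0. h k y)" if "y \<in> ball y0 1" for y y0
  proof -
    have "k \<in> S y0" if "k \<in> A" "h k y \<noteq> 0" for k
      using supp[OF that] \<open>y \<in> ball y0 1\<close> dist_triangle[of "z k" y0 y] that(1)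
      by (auto simp: S_def dist_commute)
    then have "(\<lambda>k. if k \<in> A then h k y else 0) sums (\<Sum>k\<in>S y0. if k \<in> A then h k y else 0)"
      using S(1) by (intro sums_finite) auto
    also have "(\<Sum>k\<in>S y0. if k \<in> A then h k y else 0) = (\<Sum>k\<in>S y0. h k y)"
      using S(3) by (intro sum.cong) auto
    finally show ?thesis .
  qed
  have F: "F y = (\<Sum>k\<in>S y0. h k y)" if "y \<in> ball y0 1" for y y0
    using sums_unique[OF sums[OF that]] by (simp add: F_def)
  have C2S: "C2_on UNIV (\<lambda>y. \<Sum>k\<in>S y0. h k y)" for y0
    using S C2 by (intro C2_sum) blast+
  have pdF: "pd i F y = (\<Sum>k\<in>S y0. pd i (h k) y)" if "y \<in> ball y0 1" for i y y0
  proof -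
    have "pd i F y = pd i (\<lambda>y. \<Sum>k\<in>S y0. h k y) y"
      by (rule pd_cong_open[OF open_ball that F])
    also have "\<dots> = (\<Sum>k\<in>S y0. pd i (h k) y)"
      using S C2 C2_D(1) by (intro pd_sum) blast+
    finally show ?thesis .
  qed
  have pddF: "pd i (pd j F) y = (\<Sum>k\<in>S y0. pd i (pd j (h k)) y)" if "y \<in> ball y0 1" for i j y y0
  proof -
    have "pd i (pd j F) y = pd i (\<lambda>y. \<Sum>k\<in>S y0. pd j (h k) y) y"
      by (rule pd_cong_open[OF open_ball that pdF])
    also have "\<dots> = (\<Sum>k\<in>S y0. pd i (pd j (h k)) y)"
      using S C2 C2_D(2) by (intro pd_sum) blast+
    finally show ?thesis .
  qed
  have bd: "\<bar>\<Sum>k\<in>S y. g k\<bar> \<le> M * D" if "\<And>k. k \<in> A \<Longrightarrow> \<bar>g k\<bar> \<le> D" for g y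
  proof -
    have "\<bar>\<Sum>k\<in>S y. g k\<bar> \<le> (\<Sum>k\<in>S y. \<bar>g k\<bar>)" by (rule sum_abs)
    also have "\<dots> \<le> card (S y) * D"
      using sum_bounded_above[of "S y" "\<lambda>k. \<bar>g k\<bar>" D] that S(3) by auto
    also have "\<dots> \<le> M * D"
      using S(2) D(4) by (intro mult_right_mono) auto
    finally show ?thesis .
  qed
  have y: "y \<in> ball y 1" by simp
  show "C2_on UNIV F"
  proof (rule C2_on_UNIV_local)
    fix x
    show "\<exists>U g. open U \<and> x \<in> U \<and> C2_on UNIV g \<and> (\<forall>y\<in>U. F y = g y)"
      using F C2S[of x] by (intro exI[of _ "ball x 1"] exI[of _ "\<lambda>y. \<Sum>k\<in>S x. h k y"]) auto
  qed
  show "\<bar>F y\<bar> \<le> M * D"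
    unfolding F[OF y] by (rule bd[OF D(1)])
  show "\<bar>pd i F y\<bar> \<le> M * D"
    unfolding pdF[OF y] by (rule bd[OF D(2)])
  show "\<bar>pd i (pd j F) y\<bar> \<le> M * D"
    unfolding pddF[OF y] by (rule bd[OF D(3)])
  show "(\<lambda>k. if k \<in> A then h k y else 0) sums F y"
    using sums[OF y] F[OF y] by simp
qed

text \<open>The constant comes from the coefficient bounds and the dimensions alone, each entry of
  \<open>amat\<close> being a sum of \<open>CARD('N)\<close> bounded products. It is thus uniform in
  \<open>f\<close> and \<open>y\<close>.\<close>

lemma Lgen_bounded:
  fixes b :: "real^'J::finite \<Rightarrow> real^'J" and \<sigma> :: "real^'J \<Rightarrow> real^'N::finite^'J"
  assumes "bounded (range b)" "bounded (range \<sigma>)"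
  obtains C where "C > 0" "\<And>f y D. 0 \<le> D \<Longrightarrow> (\<And>i. \<bar>pd i f y\<bar> \<le> D) \<Longrightarrow>
    (\<And>i j. \<bar>pd i (pd j f) y\<bar> \<le> D) \<Longrightarrow> \<bar>Lgen b \<sigma> f y\<bar> \<le> C * D"
proof -
  obtain Bb where Bb: "Bb > 0" "\<And>y. norm (b y) \<le> Bb"
    using assms(1) unfolding bounded_pos by auto
  obtain Bs where Bs: "Bs > 0" "\<And>y. norm (\<sigma> y) \<le> Bs"
    using assms(2) unfolding bounded_pos by auto
  have s: "\<bar>\<sigma> y $ i $ k\<bar> \<le> Bs" for y i k
    using component_le_norm_cart[of "\<sigma> y $ i" k] Finite_Cartesian_Product.norm_nth_le[of "\<sigma> y" i] Bs(2)[of y] by linarith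
  have b: "\<bar>b y $ i\<bar> \<le> Bb" for y i
    using component_le_norm_cart[of "b y" i] Bb(2)[of y] by linarith
  define Ba where "Ba = CARD('N) * (Bs * Bs)"
  have a: "\<bar>amat \<sigma> y $ i $ j\<bar> \<le> Ba" for y i j
  proof -
    have "\<bar>amat \<sigma> y $ i $ j\<bar> = \<bar>\<Sum>k\<in>UNIV. \<sigma> y $ i $ k * \<sigma> y $ j $ k\<bar>"
      by (simp add: amat_def matrix_matrix_mult_def transpose_def)
    also have "\<dots> \<le> (\<Sum>k\<in>UNIV. \<bar>\<sigma> y $ i $ k * \<sigma> y $ j $ k\<bar>)" by (rule sum_abs)
    also have "\<dots> \<le> (\<Sum>k\<in>(UNIV::'N set). Bs * Bs)"
      unfolding abs_mult using s Bs(1) by (intro sum_mono mult_mono) auto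
    finally show ?thesis by (simp add: Ba_def)
  qed
  have Ba: "Ba > 0" using Bs by (simp add: Ba_def)
  define C where "C = CARD('J) * Bb + 1/2 * (CARD('J) * (CARD('J) * Ba))"
  have C: "C > 0" using Bb(1) Ba by (auto simp: C_def intro!: add_pos_pos)
  show ?thesis
  proof (rule that[OF C])
    fix f :: "real^'J \<Rightarrow> real" and y and D :: real
    assume D: "0 \<le> D" "\<And>i. \<bar>pd i f y\<bar> \<le> D" "\<And>i j. \<bar>pd i (pd j f) y\<bar> \<le> D"
    have "\<bar>\<Sum>i\<in>UNIV. b y $ i * pd i f y\<bar> \<le> (\<Sum>i\<in>(UNIV::'J set). Bb * D)"
      using D b Bb(1) by (intro order_trans[OF sum_abs] sum_mono) (auto simp: abs_mult intro!: mult_mono)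
    moreover have "\<bar>\<Sum>i\<in>UNIV. \<Sum>j\<in>UNIV. amat \<sigma> y $ i $ j * pd i (pd j f) y\<bar>
       \<le> (\<Sum>i\<in>(UNIV::'J set). \<Sum>j\<in>(UNIV::'J set). Ba * D)"
      using D a Ba
      by (intro order_trans[OF sum_abs] sum_mono) (auto simp: abs_mult intro!: mult_mono)
    ultimately show "\<bar>Lgen b \<sigma> f y\<bar> \<le> C * D"
      unfolding Lgen_def C_def by (simp add: algebra_simps abs_le_iff)
  qed
qed

text \<open>One point of \<open>S\<close> is chosen from each cubic cell that meets
  \<open>S\<close>, and cells are numbered through \<open>to_nat\<close>. Points within
  \<open>R\<close> of \<open>y\<close> lie in cells whose integer coordinates differ boundedly from
  those of \<open>y\<close>, which bounds their number independently of \<open>y\<close>.\<close>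

lemma grid_selection:
  fixes S :: "(real^'J::finite) set" and r R :: real
  assumes r: "r > 0"
  obtains A :: "nat set" and z :: "nat \<Rightarrow> real^'J" and M :: nat
  where "\<And>k. k \<in> A \<Longrightarrow> z k \<in> S" "\<And>y. y \<in> S \<Longrightarrow> \<exists>k\<in>A. dist (z k) y < r"
    "\<And>y. finite {k\<in>A. dist (z k) y \<le> R}" "\<And>y. card {k\<in>A. dist (z k) y \<le> R} \<le> M"
proof -
  \<comment> \<open>Two points of one cell differ by at most \<open>s\<close> in each coordinate,
    hence by at most \<open>CARD('J) * s\<close> in norm; the added 1 makes this strictly less than
    \<open>r\<close>.\<close>
  define s where "s = r / (real CARD('J) + 1)"
  have s: "s > 0" using r by (auto simp: s_def intro!: divide_pos_pos)
  define cell :: "real^'J \<Rightarrow> int^'J" where "cell y = (\<chi> i. \<lfloor>y $ i / s\<rfloor>)" for y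
  define A where "A = (to_nat \<circ> cell) ` S"
  define z where "z k = (SOME y. y \<in> S \<and> to_nat (cell y) = k)" for k
  have z: "z k \<in> S \<and> to_nat (cell (z k)) = k" if "k \<in> A" for k
    unfolding z_def by (rule someI_ex) (use that in \<open>auto simp: A_def\<close>)
  \<comment> \<open>The added 1 absorbs the rounding by the floors.\<close>
  define K where "K = \<lceil>R / s\<rceil> + 1"
  define box :: "(int^'J) set" where "box = vec_lambda ` (PiE UNIV (\<lambda>_. {-K..K}))"
  have box: "finite box" unfolding box_def by (intro finite_imageI finite_PiE) auto
  \<comment> \<open>An index is recovered from its cell, since
    \<open>k = to_nat (cell (z k))\<close> on \<open>A\<close>.\<close>
  have inj: "inj_on (\<lambda>k. cell (z k) - cell y) {k\<in>A. dist (z k) y \<le> R}" for y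
    by (rule inj_onI) (metis (no_types, lifting) diff_add_cancel mem_Collect_eq z)
  have into: "cell (z k) - cell y \<in> box" if "dist (z k) y \<le> R" for k y
  proof -
    have "(cell (z k) - cell y) $ i \<in> {-K..K}" for i
    proof -
      have "\<bar>z k $ i - y $ i\<bar> \<le> R"
        using component_le_norm_cart[of "z k - y" i] that by (simp add: dist_norm)
      then have "\<bar>z k $ i / s - y $ i / s\<bar> \<le> R / s"
        using s by (simp add: diff_divide_distrib[symmetric] divide_right_mono abs_divide)
      then show ?thesis unfolding cell_def K_def by simp linarith
    qed
    then have "($) (cell (z k) - cell y) \<in> PiE UNIV (\<lambda>_. {-K..K})" by auto
    then show ?thesis unfolding box_def by (metis image_eqI vec_nth_inverse)
  qed
  have sub: "(\<lambda>k. cell (z k) - cell y) ` {k\<in>A. dist (z k) y \<le> R} \<subseteq> box" for y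
    using into by auto
  show ?thesis
  proof (rule that[of A z "card box"])
    show "z k \<in> S" if "k \<in> A" for k using z that by blast
    show "\<exists>k\<in>A. dist (z k) y < r" if "y \<in> S" for y
    proof
      let ?k = "to_nat (cell y)"
      show k: "?k \<in> A" using that by (auto simp: A_def)
      have "cell (z ?k) = cell y" using z[OF k] by simp
      then have e: "\<lfloor>z ?k $ i / s\<rfloor> = \<lfloor>y $ i / s\<rfloor>" for i
        by (simp add: cell_def vec_eq_iff)
      have "\<bar>(z ?k - y) $ i\<bar> \<le> s" for i
      proof -
        have "\<bar>z ?k $ i / s - y $ i / s\<bar> \<le> 1" using e[of i] by linarith
        then show ?thesis using s by (simp add: diff_divide_distrib[symmetric] abs_divide)
      qed
      then have "norm (z ?k - y) \<le> (\<Sum>i\<in>(UNIV::'J set). s)"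
        by (intro order_trans[OF norm_le_l1_cart] sum_mono)
      also have "\<dots> < r" using r by (simp add: s_def field_simps)
      finally show "dist (z ?k) y < r" by (simp add: dist_norm)
    qed
    show "finite {k\<in>A. dist (z k) y \<le> R}" for y
      using inj_on_finite[OF inj sub box] .
    show "card {k\<in>A. dist (z k) y \<le> R} \<le> card box" for y
      using card_inj_on_le[OF inj sub box] .
  qed
qed

section \<open>Test functions from uniform bumps\<close>

text \<open>The number \<open>r\<close> bounds the plateau from below and, through
  \<open>1 / r\<close>, the derivatives from above. A common \<open>r\<close> for all centres is
  thus exactly the uniformity that sums of bumps require.\<close>

definition bump_at ::
  "'i set \<Rightarrow> ('i \<Rightarrow> real^'J::finite \<Rightarrow> real) \<Rightarrow> ('i \<Rightarrow> real^'J \<Rightarrow> real^'J) \<Rightarrow> (real^'J) set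
     \<Rightarrow> real \<Rightarrow> real \<Rightarrow> real^'J \<Rightarrow> (real^'J \<Rightarrow> real) \<Rightarrow> bool" where
  "bump_at I \<phi> \<gamma> V \<epsilon> r y h \<longleftrightarrow> h \<in> Hset I \<phi> \<gamma> V \<and> C2_on UNIV h \<and> (\<forall>w. 0 \<le> h w \<and> h w \<le> 1)
     \<and> (\<forall>w. h w \<noteq> 0 \<longrightarrow> dist y w \<le> \<epsilon>) \<and> (\<forall>w. dist y w < r \<longrightarrow> h w = 1)
     \<and> (\<forall>i w. \<bar>pd i h w\<bar> \<le> 1 / r) \<and> (\<forall>i j w. \<bar>pd i (pd j h) w\<bar> \<le> 1 / r)"

lemma C2c_zero: "C2c S (\<lambda>_. 0)"
  using C2_const[of 0] by (auto simp: C2c_def C2_near_def)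

text \<open>Fills the indices of the series that are not selected, as \<open>AssumptionTF\<close>
  asks for a sequence over all natural numbers.\<close>

lemma zero_in_Hset: "(\<lambda>_. 0) \<in> Hset I \<phi> \<gamma> V"
proof -
  have "C2c_plus (closure (GG I \<phi>)) (\<lambda>_. 0)"
    unfolding C2c_plus_def using C2c_zero by (intro exI[of _ "\<lambda>_. 0"] exI[of _ 0]) auto
  moreover have "grad (\<lambda>_. 0) y = 0" for y :: "real^'a::finite"
    by (simp add: grad_def pd_const vec_eq_iff)
  ultimately show ?thesis
    unfolding Hset_def by (auto intro: exI[of _ 1])
qed

text \<open>Grid-selected bumps cover the closed domain by their plateaus, while at most
  \<open>M\<close> of their supports meet at any point. Dropping those centred near \<open>x\<close>
  makes the sum vanish near \<open>x\<close> and stay at least 1 far away; the bounds depend neither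
  on \<open>x\<close> nor on \<open>N\<close>.\<close>

lemma AssumptionTF_if_uniform_bumps:
  fixes I :: "'i set" and \<phi> :: "'i \<Rightarrow> real^'J::finite \<Rightarrow> real" and \<gamma> :: "'i \<Rightarrow> real^'J \<Rightarrow> real^'J"
    and b :: "real^'J \<Rightarrow> real^'J" and \<sigma> :: "real^'J \<Rightarrow> real^'N::finite^'J"
  assumes bumps: "\<And>\<epsilon>. \<epsilon> > 0 \<Longrightarrow> \<exists>r>0. \<forall>y\<in>closure (GG I \<phi>). \<exists>h. bump_at I \<phi> \<gamma> V \<epsilon> r y h"
    and bdd: "bounded (range b)" "bounded (range \<sigma>)"
  shows "AssumptionTF b \<sigma> I \<phi> \<gamma> V"
  unfolding AssumptionTF_def
proof (intro allI impI)
  fix \<epsilon> :: real and N :: nat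
  assume \<epsilon>: "\<epsilon> > 0"
  let ?G = "closure (GG I \<phi>)"
  obtain r where r: "r > 0" and "\<forall>y\<in>?G. \<exists>h. bump_at I \<phi> \<gamma> V \<epsilon> r y h"
    using bumps[OF \<epsilon>] by blast
  then obtain H where H: "\<And>y. y \<in> ?G \<Longrightarrow> bump_at I \<phi> \<gamma> V \<epsilon> r y (H y)" by metis
  obtain A :: "nat set" and z :: "nat \<Rightarrow> real^'J" and M :: nat where
    z: "\<And>k. k \<in> A \<Longrightarrow> z k \<in> ?G" and cover: "\<And>y. y \<in> ?G \<Longrightarrow> \<exists>k\<in>A. dist (z k) y < r"
    and fin: "\<And>y. finite {k\<in>A. dist (z k) y \<le> \<epsilon> + 1}"
    and card: "\<And>y. card {k\<in>A. dist (z k) y \<le> \<epsilon> + 1} \<le> M"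
    using grid_selection[OF r, of ?G "\<epsilon> + 1"] by blast
  define h where "h k = H (z k)" for k
  have h: "bump_at I \<phi> \<gamma> V \<epsilon> r (z k) (h k)" if "k \<in> A" for k
    using H z that by (simp add: h_def)
  \<comment> \<open>Dominates both the bound 1 on values and the bound \<open>1 / r\<close> on
    derivatives.\<close>
  define D where "D = 1 + 1 / r"
  have D: "0 \<le> D" "1 \<le> D" "1 / r \<le> D" using r by (auto simp: D_def)
  have hC2: "C2_on UNIV (h k)" and h0: "0 \<le> h k y" and hD: "\<bar>h k y\<bar> \<le> D"
    and supp: "h k y \<noteq> 0 \<Longrightarrow> dist (z k) y \<le> \<epsilon>" and h1: "dist (z k) y < r \<Longrightarrow> h k y = 1"
    and pdD: "\<bar>pd i (h k) y\<bar> \<le> D" and pddD: "\<bar>pd i (pd j (h k)) y\<bar> \<le> D"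
    and hH: "h k \<in> Hset I \<phi> \<gamma> V" if "k \<in> A" for k y i j
    using h[OF that] D order_trans[OF _ D(3)] order_trans[OF _ D(2)] unfolding bump_at_def
    by auto
  have hC2c: "C2c ?G (h k)" if "k \<in> A" for k
  proof -
    have "{y \<in> ?G. h k y \<noteq> 0} \<subseteq> cball (z k) \<epsilon>" using supp[OF that] by auto
    then show ?thesis
      using hC2[OF that] bounded_subset[OF bounded_cball] unfolding C2c_def C2_near_def by blast
  qed
  \<comment> \<open>Supports have radius at most \<open>\<epsilon>\<close>, so beyond the threshold
    \<open>3 * \<epsilon> / 2 = \<epsilon> + \<epsilon> / 2\<close> no support enters the open ball
    of radius \<open>\<epsilon> / 2\<close>, nor its boundary. A bump equal to 1 at distance over
    \<open>3 * \<epsilon>\<close> from \<open>x\<close> is centred over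
    \<open>2 * \<epsilon>\<close> away and is kept.\<close>
  define far where "far x = {k\<in>A. 3 * \<epsilon> / 2 < dist (z k) x}" for x
  define F where "F x = (\<lambda>y. \<Sum>k. if k \<in> far x then h k y else 0)" for x
  have fA: "k \<in> A" if "k \<in> far x" for k x using that by (simp add: far_def)
  have sub: "{k\<in>far x. dist (z k) y \<le> \<epsilon> + 1} \<subseteq> {k\<in>A. dist (z k) y \<le> \<epsilon> + 1}" for x y
    by (auto simp: far_def)
  have fin': "finite {k\<in>far x. dist (z k) y \<le> \<epsilon> + 1}" for x y
    using finite_subset[OF sub fin] .
  have card': "card {k\<in>far x. dist (z k) y \<le> \<epsilon> + 1} \<le> M" for x y
    using card_mono[OF fin sub] card order_trans by blast
  have sum: "C2_on UNIV (F x)" "\<bar>F x y\<bar> \<le> M * D" "\<bar>pd i (F x) y\<bar> \<le> M * D"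
    "\<bar>pd i (pd j (F x)) y\<bar> \<le> M * D" "(\<lambda>k. if k \<in> far x then h k y else 0) sums F x y"
    for x y i j
  proof -
    note fA = fA[of _ x]
    note * = locally_finite_C2_sum[of "far x" h z \<epsilon> M D,
        OF hC2[OF fA] supp[OF fA] fin' card' hD[OF fA] pdD[OF fA] pddD[OF fA] D(1)]
    show "C2_on UNIV (F x)" "\<bar>F x y\<bar> \<le> M * D" "\<bar>pd i (F x) y\<bar> \<le> M * D"
      "\<bar>pd i (pd j (F x)) y\<bar> \<le> M * D" "(\<lambda>k. if k \<in> far x then h k y else 0) sums F x y"
      unfolding F_def by (rule *; assumption)+
  qed
  obtain C where C: "C > 0" "\<And>f y D. 0 \<le> D \<Longrightarrow> (\<And>i. \<bar>pd i f y\<bar> \<le> D) \<Longrightarrow>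
      (\<And>i j. \<bar>pd i (pd j f) y\<bar> \<le> D) \<Longrightarrow> \<bar>Lgen b \<sigma> f y\<bar> \<le> C * D"
    using Lgen_bounded[OF bdd] by blast
  have L: "\<bar>Lgen b \<sigma> (F x) y\<bar> \<le> C * (M * D) + 1" for x y
    using C(2)[of "M * D" "F x" y] sum(3,4) D(1) by force
  show "\<exists>(f :: real^'J \<Rightarrow> real^'J \<Rightarrow> real) C c. C > 0 \<and> c > 0 \<and>
      (\<forall>x\<in>closure (GG I \<phi>) \<inter> cball 0 (real N).
          C2b (closure (GG I \<phi>)) (f x)
        \<and> (\<forall>y\<in>closure (GG I \<phi>). f x y \<ge> 0)
        \<and> (\<exists>h :: nat \<Rightarrow> real^'J \<Rightarrow> real.
              (\<forall>k. h k \<in> Hset I \<phi> \<gamma> V \<and> C2c (closure (GG I \<phi>)) (h k))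
            \<and> (\<forall>y\<in>closure (GG I \<phi>). (\<lambda>k. h k y) sums f x y))
        \<and> (\<forall>y\<in>closure (GG I \<phi>). norm (y - x) \<le> \<epsilon> / 2 \<longrightarrow> f x y = 0)
        \<and> (\<forall>y\<in>closure (GG I \<phi>). norm (y - x) > 3 * \<epsilon> \<longrightarrow> f x y > c)
        \<and> (\<forall>y\<in>closure (GG I \<phi>). \<bar>Lgen b \<sigma> (f x) y\<bar> \<le> C))"
  \<comment> \<open>The added 1 keeps the bound positive even for \<open>M = 0\<close>;
    \<open>1 / 2\<close> lies strictly below the value 1 that a single bump contributes.\<close>
  proof (rule exI[of _ F], rule exI[of _ "C * (M * D) + 1"], rule exI[of _ "1 / 2"],
      intro conjI ballI impI L)
    show "0 < C * (M * D) + 1" using C(1) D(1) by (auto intro!: add_nonneg_pos)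
    show "0 < (1 / 2 :: real)" by simp
    fix x assume "x \<in> ?G \<inter> cball 0 (real N)"
    show "C2b ?G (F x)"
      unfolding C2b_def C2_near_def bounded_iff using sum(1-4)[where x=x] by (auto intro!: exI[of _ "M * D"] exI[of _ UNIV])
    show "\<exists>h :: nat \<Rightarrow> real^'J \<Rightarrow> real. (\<forall>k. h k \<in> Hset I \<phi> \<gamma> V \<and> C2c ?G (h k))
            \<and> (\<forall>y\<in>?G. (\<lambda>k. h k y) sums F x y)"
    proof (intro exI conjI allI ballI)
      fix k
      show "(\<lambda>y. if k \<in> far x then h k y else 0) \<in> Hset I \<phi> \<gamma> V"
        using hH[OF fA, of k x] zero_in_Hset[of I \<phi> \<gamma> V] by (cases "k \<in> far x") auto
      show "C2c ?G (\<lambda>y. if k \<in> far x then h k y else 0)"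
        using hC2c[OF fA, of k x] C2c_zero by (cases "k \<in> far x") auto
    next
      fix y
      show "(\<lambda>k. if k \<in> far x then h k y else 0) sums F x y" by (rule sum(5))
    qed
    fix y assume y: "y \<in> ?G"
    show "0 \<le> F x y"
      using sums_le[OF _ sums_zero sum(5)[where x=x and y=y]] h0[OF fA] by force
    show "F x y = 0" if "norm (y - x) \<le> \<epsilon> / 2"
    proof -
      have "h k y = 0" if "k \<in> far x" for k
      proof (rule ccontr)
        assume "h k y \<noteq> 0"
        then have "dist (z k) y \<le> \<epsilon>" using supp[OF fA[OF that]] by blast
        then have "dist (z k) x \<le> 3 * \<epsilon> / 2"
          using \<open>norm (y - x) \<le> \<epsilon> / 2\<close> dist_triangle[of "z k" x y] by (simp add: dist_norm)
        then show False using that by (simp add: far_def)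
      qed
      then have "(\<lambda>k. if k \<in> far x then h k y else 0) = (\<lambda>_. 0)" by auto
      then show ?thesis unfolding F_def by simp
    qed
    show "1 / 2 < F x y" if far: "3 * \<epsilon> < norm (y - x)"
    proof -
      obtain k where k: "k \<in> A" "dist (z k) y < r" using cover[OF y] by blast
      have hk: "h k y = 1" using h1[OF k] .
      \<comment> \<open>The distance is at hand only as less than \<open>r\<close>; since the bump
        is nonzero at \<open>y\<close>, its support condition turns this into a bound by
        \<open>\<epsilon>\<close>.\<close>
      have "dist (z k) y \<le> \<epsilon>" using supp[OF k(1), of y] hk by simp
      then have "3 * \<epsilon> / 2 < dist (z k) x"
        using far dist_triangle[of y x "z k"] \<epsilon> by (simp add: dist_norm norm_minus_commute)
      then have kf: "k \<in> far x" using k(1) by (simp add: far_def)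
      have "(\<Sum>k\<in>{k}. if k \<in> far x then h k y else 0) \<le> F x y"
        unfolding F_def using sum(5)[where x=x and y=y] h0[OF fA]
        by (intro sum_le_suminf) (auto simp: sums_iff)
      then show ?thesis using hk kf by simp
    qed
  qed
qed

section \<open>Barriers\<close>

text \<open>The value 2 is where the cutoff has reached 0, and
  \<open>n + (2 * \<kappa>) *\<^sub>R w\<close> is the gradient of the barrier at
  \<open>w = y - z\<close>. The triple \<open>n\<close>, \<open>\<kappa>\<close>,
  \<open>\<rho>\<close> is kept apart from \<open>z\<close> so that one profile can be translated to
  many centres.\<close>

definition barrier_at ::
  "'i set \<Rightarrow> ('i \<Rightarrow> real^'J::finite \<Rightarrow> real) \<Rightarrow> ('i \<Rightarrow> real^'J \<Rightarrow> real^'J) \<Rightarrow> (real^'J) set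
     \<Rightarrow> real^'J \<Rightarrow> real \<Rightarrow> real \<Rightarrow> real^'J \<Rightarrow> bool" where
  "barrier_at I \<phi> \<gamma> V n \<kappa> \<rho> z \<longleftrightarrow>
    (\<forall>y\<in>closure (GG I \<phi>). norm (y - z) \<le> \<rho> \<longrightarrow>
        (\<rho> / 2 \<le> norm (y - z) \<longrightarrow> 2 \<le> inner n (y - z) + \<kappa> * (norm (y - z))\<^sup>2)
      \<and> (\<forall>i\<in>Idx I \<phi> y. 0 \<le> inner (\<gamma> i y) (n + (2 * \<kappa>) *\<^sub>R (y - z))))
    \<and> V \<inter> cball z \<rho> \<subseteq> {z}"

text \<open>Near a point of \<open>V\<close> the bump is constant: it is 1 near \<open>z\<close>,
  and every other point of \<open>V\<close> lies beyond the support radius. The sign condition holds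
  for each \<open>\<gamma> i\<close> and passes to their nonnegative combinations.\<close>

lemma translated_bump_in_Hset:
  assumes bar: "barrier_at I \<phi> \<gamma> V n \<kappa> \<rho> z" and "r > 0" and T: "C2_on UNIV T"
    and T0: "\<And>w. \<rho> \<le> norm w \<Longrightarrow> T w = 0" and T1: "\<And>w. norm w < r \<Longrightarrow> T w = 1"
    and grad: "\<forall>w d. (norm w \<le> \<rho> \<longrightarrow> 0 \<le> inner d (n + (2 * \<kappa>) *\<^sub>R w)) \<longrightarrow>
       (\<rho> / 2 \<le> norm w \<longrightarrow> norm w \<le> \<rho> \<longrightarrow> 2 \<le> inner n w + \<kappa> * (norm w)\<^sup>2) \<longrightarrow>
       inner d (grad T w) \<le> 0"
  shows "(\<lambda>y. T (y - z)) \<in> Hset I \<phi> \<gamma> V"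
  unfolding Hset_def
proof (intro CollectI conjI ballI)
  let ?G = "closure (GG I \<phi>)" and ?h = "\<lambda>y. T (y - z)"
  have "{y \<in> ?G. ?h y \<noteq> 0} \<subseteq> cball z \<rho>"
    using T0 by (force simp: dist_norm norm_minus_commute)
  then have "C2c ?G ?h"
    using C2_translate[OF T] bounded_subset[OF bounded_cball] unfolding C2c_def C2_near_def by blast
  then show "C2c_plus ?G ?h"
    unfolding C2c_plus_def by (intro exI[of _ ?h] exI[of _ 0]) auto
next
  fix x assume x: "x \<in> V"
  show "\<exists>\<delta>>0. \<exists>k. \<forall>y\<in>closure (GG I \<phi>) \<inter> ball x \<delta>. T (y - z) = k"
  proof (cases "x = z")
    case True
    then show ?thesis
      using T1 \<open>r > 0\<close> by (intro exI[of _ r] conjI exI[of _ 1]) (auto simp: dist_norm norm_minus_commute)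
  next
    case False
    then have far: "\<rho> < dist z x" using bar x by (auto simp: barrier_at_def)
    have "T (y - z) = 0" if "y \<in> ball x (dist z x - \<rho>)" for y
    proof (rule T0)
      show "\<rho> \<le> norm (y - z)"
        using that dist_triangle[of z x y] by (simp add: dist_norm norm_minus_commute)
    qed
    then show ?thesis
      using far by (intro exI[of _ "dist z x - \<rho>"]) auto
  qed
next
  fix y d assume y: "y \<in> frontier (GG I \<phi>)" and d: "d \<in> dcone I \<phi> \<gamma> y"
  have yG: "y \<in> closure (GG I \<phi>)" using y by (simp add: frontier_def)
  have g: "grad (\<lambda>y. T (y - z)) y = grad T (y - z)"
    by (simp add: grad_def pd_translate)
  obtain s where s: "d = (\<Sum>i\<in>Idx I \<phi> y. s i *\<^sub>R \<gamma> i y)" "\<forall>i\<in>Idx I \<phi> y. 0 \<le> s i"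
    using d y by (auto simp: dcone_def)
  have "inner (\<gamma> i y) (grad T (y - z)) \<le> 0" if "i \<in> Idx I \<phi> y" for i
    using grad bar yG that unfolding barrier_at_def by blast
  then show "inner d (grad (\<lambda>y. T (y - z)) y) \<le> 0"
    unfolding g s(1) inner_sum_left using s(2)
    by (intro sum_nonpos) (auto simp: mult_nonneg_nonpos)
qed

text \<open>A failure of uniformity would produce a sequence of points needing ever smaller bumps; but one bump
  profile serves infinitely many members of any sequence.\<close>

lemma uniform_bumps_if_sequential_barriers:
  fixes \<phi> :: "'i \<Rightarrow> real^'J::finite \<Rightarrow> real"
  assumes seq: "\<And>\<epsilon> y. \<epsilon> > 0 \<Longrightarrow> (\<And>k::nat. y k \<in> closure (GG I \<phi>)) \<Longrightarrow>
      \<exists>n \<kappa> \<rho>. 0 < \<rho> \<and> \<rho> \<le> \<epsilon> \<and>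
        (\<forall>\<eta>>0. \<forall>K. \<exists>k\<ge>K. \<exists>z. dist z (y k) < \<eta> \<and> barrier_at I \<phi> \<gamma> V n \<kappa> \<rho> z)"
    and \<epsilon>: "\<epsilon> > 0"
  shows "\<exists>r>0. \<forall>y\<in>closure (GG I \<phi>). \<exists>h. bump_at I \<phi> \<gamma> V \<epsilon> r y h"
proof (rule ccontr)
  assume "\<not> ?thesis"
  then have "\<exists>y. y \<in> closure (GG I \<phi>) \<and> (\<forall>h. \<not> bump_at I \<phi> \<gamma> V \<epsilon> (1 / (real k + 1)) y h)" for k
    by (auto dest!: spec[of _ "1 / (real k + 1)"])
  then obtain y where yG: "\<And>k. y k \<in> closure (GG I \<phi>)"
    and no: "\<And>k h. \<not> bump_at I \<phi> \<gamma> V \<epsilon> (1 / (real k + 1)) (y k) h" by metis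
  \<comment> \<open>The barrier is centred at \<open>z\<close> rather than at \<open>y k\<close>:
    half of \<open>\<epsilon>\<close> is spent on the support radius and half on the
    displacement.\<close>
  obtain n \<kappa> \<rho> where \<rho>: "0 < \<rho>" "\<rho> \<le> \<epsilon> / 2"
    and bar: "\<And>\<eta> K. \<eta> > 0 \<Longrightarrow> \<exists>k\<ge>K. \<exists>z. dist z (y k) < \<eta> \<and> barrier_at I \<phi> \<gamma> V n \<kappa> \<rho> z"
    using seq[OF half_gt_zero[OF \<epsilon>], of y] yG by metis
  obtain T r where r: "r > 0" and T: "C2_on UNIV T" "\<forall>w. 0 \<le> T w" "\<forall>w. T w \<le> 1"
    and T0: "\<forall>w. \<rho> \<le> norm w \<longrightarrow> T w = 0" and T1: "\<forall>w. norm w < r \<longrightarrow> T w = 1"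
    and pdT: "\<forall>i w. \<bar>pd i T w\<bar> \<le> 1 / r" "\<forall>i j w. \<bar>pd i (pd j T) w\<bar> \<le> 1 / r"
    and gT: "\<forall>w d. (norm w \<le> \<rho> \<longrightarrow> 0 \<le> inner d (n + (2 * \<kappa>) *\<^sub>R w)) \<longrightarrow>
       (\<rho> / 2 \<le> norm w \<longrightarrow> norm w \<le> \<rho> \<longrightarrow> 2 \<le> inner n w + \<kappa> * (norm w)\<^sup>2) \<longrightarrow>
       inner d (grad T w) \<le> 0"
    using barrier_bump_exists[OF \<rho>(1), of n \<kappa>] by blast
  obtain K :: nat where K: "1 / (r / 2) < real K"
    using reals_Archimedean2 by blast
  \<comment> \<open>With displacement below \<open>r / 2\<close>, the plateau of radius
    \<open>r\<close> about \<open>z\<close> contains the ball of radius \<open>r / 2\<close> about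
    \<open>y k\<close>; the choice of \<open>K\<close> ensures
    \<open>1 / (real k + 1) \<le> r / 2\<close>.\<close>
  obtain k z where k: "k \<ge> K" and z: "dist z (y k) < min (r / 2) (\<epsilon> / 2)"
    and b: "barrier_at I \<phi> \<gamma> V n \<kappa> \<rho> z"
    using bar[of "min (r / 2) (\<epsilon> / 2)" K] r \<epsilon> by auto
  have rk: "1 / (r / 2) \<le> real k + 1" using k K by linarith
  then have k1: "1 / (real k + 1) \<le> r / 2"
    using r by (simp add: field_simps)
  have "1 / r \<le> 1 / (r / 2)" using r by (simp add: field_simps)
  then have k2: "1 / r \<le> 1 / (1 / (real k + 1))" using rk by simp
  define h where "h = (\<lambda>y. T (y - z))"
  have pdh: "pd i h = (\<lambda>y. pd i T (y - z))" for i
    using pd_translate unfolding h_def by blast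
  have pddh: "pd i (pd j h) w = pd i (pd j T) (w - z)" for i j w
    unfolding pdh by (rule pd_translate)
  have "bump_at I \<phi> \<gamma> V \<epsilon> (1 / (real k + 1)) (y k) h"
    unfolding bump_at_def
  proof (intro conjI allI impI)
    show "h \<in> Hset I \<phi> \<gamma> V"
      unfolding h_def by (rule translated_bump_in_Hset[OF b r T(1) T0[rule_format] T1[rule_format] gT])
    show "C2_on UNIV h" unfolding h_def by (rule C2_translate[OF T(1)])
    show "0 \<le> h w" "h w \<le> 1" for w using T by (auto simp: h_def)
    show "dist (y k) w \<le> \<epsilon>" if "h w \<noteq> 0" for w
    proof -
      have "norm (w - z) < \<rho>" using that T0 by (force simp: h_def)
      then show ?thesis
        using z \<rho>(2) dist_triangle[of "y k" w z] by (simp add: dist_norm norm_minus_commute)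
    qed
    show "h w = 1" if "dist (y k) w < 1 / (real k + 1)" for w
    proof -
      have "norm (w - z) < r"
        using that z k1 dist_triangle[of z w "y k"] by (simp add: dist_norm norm_minus_commute)
      then show ?thesis using T1 by (simp add: h_def)
    qed
    show "\<bar>pd i h w\<bar> \<le> 1 / (1 / (real k + 1))" for i w
      unfolding pdh using pdT(1)[rule_format] k2 by (rule order_trans)
    show "\<bar>pd i (pd j h) w\<bar> \<le> 1 / (1 / (real k + 1))" for i j w
      unfolding pddh using pdT(2)[rule_format] k2 by (rule order_trans)
  qed
  then show False using no by blast
qed

section \<open>Explicit barriers at points of a piecewise C1 domain\<close>

lemma finite_isolated_cball:
  fixes V :: "'a::metric_space set"
  assumes "finite V"
  shows "\<exists>\<rho>>0. V \<inter> cball z \<rho> \<subseteq> {z}"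
proof -
  obtain d where "d > 0" "\<forall>x\<in>V. x \<noteq> z \<longrightarrow> d \<le> dist z x"
    using finite_set_avoid[OF assms] by blast
  then show ?thesis by (intro exI[of _ "d / 2"]) force
qed

lemma finite_positive_lower_bound:
  fixes f :: "'a \<Rightarrow> real"
  assumes "finite S" "\<And>i. i \<in> S \<Longrightarrow> 0 < f i"
  obtains c where "c > 0" "\<And>i. i \<in> S \<Longrightarrow> c \<le> f i"
  \<comment> \<open>The inserted 1 makes the minimum meaningful for empty \<open>S\<close>, which
    occurs at points without active constraints.\<close>
  using assms by (intro that[of "Min (insert 1 (f ` S))"]) auto

lemma barrier_at_vertex:
  assumes A2: "Assumption2' I \<phi> \<gamma> \<sigma> V" and x: "x \<in> V" and \<epsilon>: "\<epsilon> > 0"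
  shows "\<exists>n \<kappa> \<rho>. 0 < \<rho> \<and> \<rho> \<le> \<epsilon> \<and> barrier_at I \<phi> \<gamma> V n \<kappa> \<rho> x"
proof -
  obtain v r \<alpha> where r: "r > 0" "\<alpha> > 0"
    and v: "\<And>y. y \<in> closure (GG I \<phi>) \<inter> cball x r \<Longrightarrow> \<alpha> * norm (y - x) \<le> inner v (y - x)
         \<and> (\<forall>i\<in>Idx I \<phi> y. 0 \<le> inner (\<gamma> i y) v)"
    using A2 x unfolding Assumption2'_def by meson
  obtain \<rho>' where \<rho>': "\<rho>' > 0" "V \<inter> cball x \<rho>' \<subseteq> {x}"
    using finite_isolated_cball A2 unfolding Assumption2'_def by meson
  define \<rho> where "\<rho> = min \<epsilon> (min r \<rho>')"
  have \<rho>: "0 < \<rho>" "\<rho> \<le> \<epsilon>" "\<rho> \<le> r" "\<rho> \<le> \<rho>'" using r \<rho>' \<epsilon> by (auto simp: \<rho>_def)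
  \<comment> \<open>Scales the linear lower bound \<open>\<alpha> * norm (y - x)\<close> to the
    value 2 at distance \<open>\<rho> / 2\<close>.\<close>
  define A where "A = 4 / (\<alpha> * \<rho>)"
  have A: "A > 0" using r \<rho> by (simp add: A_def)
  have "barrier_at I \<phi> \<gamma> V (A *\<^sub>R v) 0 \<rho> x"
    unfolding barrier_at_def
  proof (intro conjI ballI impI)
    fix y assume y: "y \<in> closure (GG I \<phi>)" "norm (y - x) \<le> \<rho>"
    then have "y \<in> closure (GG I \<phi>) \<inter> cball x r"
      using \<rho> by (simp add: dist_norm norm_minus_commute)
    note v = v[OF this]
    show "2 \<le> inner (A *\<^sub>R v) (y - x) + 0 * (norm (y - x))\<^sup>2" if "\<rho> / 2 \<le> norm (y - x)"
    proof -
      have "A * (\<alpha> * (\<rho> / 2)) \<le> A * inner v (y - x)"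
        using v that A r by (intro mult_left_mono order_trans[OF _ conjunct1[OF v]]) auto
      then show ?thesis using r \<rho> by (simp add: A_def)
    qed
    show "0 \<le> inner (\<gamma> i y) (A *\<^sub>R v + (2 * 0) *\<^sub>R (y - x))" if "i \<in> Idx I \<phi> y" for i
      using v that A by simp
  next
    show "V \<inter> cball x \<rho> \<subseteq> {x}" using \<rho>' \<rho> by auto
  qed
  then show ?thesis using \<rho> by blast
qed

text \<open>Before scaling, the quadratic term is \<open>(c / \<rho>) * norm w ^ 2\<close> for
  \<open>w = y - z\<close>. On the outer shell it is at least \<open>(c / 2) * norm w\<close>, beats
  the loss \<open>(c / 4) * norm w\<close>, and leaves at least \<open>c * \<rho> / 8\<close>; the
  factor \<open>16 / (\<rho> * c)\<close> turns this into 2. Its gradient has norm at most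
  \<open>2 * c\<close>, which the margin in the last assumption absorbs.\<close>

lemma barrier_at_normal:
  assumes c: "c > 0" and \<rho>: "\<rho> > 0" and V: "V \<inter> cball z \<rho> \<subseteq> {z}"
    and n: "\<And>y. y \<in> closure (GG I \<phi>) \<Longrightarrow> norm (y - z) \<le> \<rho> \<Longrightarrow> - (c / 4) * norm (y - z) \<le> inner n (y - z)"
    and \<gamma>: "\<And>y i. y \<in> closure (GG I \<phi>) \<Longrightarrow> norm (y - z) \<le> \<rho> \<Longrightarrow> i \<in> Idx I \<phi> y \<Longrightarrow>
        2 * c * norm (\<gamma> i y) \<le> inner n (\<gamma> i y)"
  shows "barrier_at I \<phi> \<gamma> V ((16 / (\<rho> * c)) *\<^sub>R n) (16 / (\<rho> * c) * (c / \<rho>)) \<rho> z"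
proof -
  define A where "A = 16 / (\<rho> * c)"
  have A: "A > 0" using c \<rho> by (simp add: A_def)
  show ?thesis
    unfolding barrier_at_def A_def[symmetric]
  proof (intro conjI ballI impI V)
    fix y assume y: "y \<in> closure (GG I \<phi>)" "norm (y - z) \<le> \<rho>"
    let ?w = "y - z"
    show "2 \<le> inner (A *\<^sub>R n) ?w + A * (c / \<rho>) * (norm ?w)\<^sup>2" if "\<rho> / 2 \<le> norm ?w"
    proof -
      have "c / 2 = (c / \<rho>) * (\<rho> / 2)" using \<rho> by simp
      also have "\<dots> \<le> (c / \<rho>) * norm ?w" using that c \<rho> by (intro mult_left_mono) auto
      finally have "c / 4 \<le> (c / \<rho>) * norm ?w - c / 4" by linarith
      then have "(c / 4) * (\<rho> / 2) \<le> ((c / \<rho>) * norm ?w - c / 4) * norm ?w"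
        using that c \<rho> by (intro mult_mono) auto
      also have "\<dots> \<le> inner n ?w + (c / \<rho>) * (norm ?w)\<^sup>2"
        using n[OF y] by (simp add: algebra_simps power2_eq_square)
      finally have "A * ((c / 4) * (\<rho> / 2)) \<le> A * (inner n ?w + (c / \<rho>) * (norm ?w)\<^sup>2)"
        using A by (intro mult_left_mono) auto
      moreover have "A * ((c / 4) * (\<rho> / 2)) = 2" using c \<rho> by (simp add: A_def)
      ultimately show ?thesis by (simp add: algebra_simps)
    qed
    show "0 \<le> inner (\<gamma> i y) (A *\<^sub>R n + (2 * (A * (c / \<rho>))) *\<^sub>R ?w)" if i: "i \<in> Idx I \<phi> y" for i
    proof -
      have "- (norm (\<gamma> i y) * \<rho>) \<le> - (norm (\<gamma> i y) * norm ?w)"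
        using y(2) by (simp add: mult_left_mono)
      also have "\<dots> \<le> inner (\<gamma> i y) ?w"
        using Cauchy_Schwarz_ineq2[of "\<gamma> i y" ?w] by linarith
      finally have "2 * (c / \<rho>) * - (norm (\<gamma> i y) * \<rho>) \<le> 2 * (c / \<rho>) * inner (\<gamma> i y) ?w"
        using c \<rho> by (intro mult_left_mono) auto
      then have "0 \<le> inner (\<gamma> i y) n + 2 * (c / \<rho>) * inner (\<gamma> i y) ?w"
        using \<gamma>[OF y i] \<rho> by (simp add: inner_commute)
      then have "0 \<le> A * (inner (\<gamma> i y) n + 2 * (c / \<rho>) * inner (\<gamma> i y) ?w)"
        using A by simp
      then show ?thesis by (simp add: inner_add_right algebra_simps)
    qed
  qed
qed

lemma pw_C1_reflD:
  assumes "pw_C1_refl I \<phi> \<gamma>" "i \<in> I"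
  shows "\<phi> i differentiable (at x)" "continuous_on UNIV (\<phi> i)" "frontier (Gi \<phi> i) = {x. \<phi> i x = 0}"
    "\<phi> i x = 0 \<Longrightarrow> grad (\<phi> i) x \<noteq> 0" "continuous_on (frontier (Gi \<phi> i)) (\<gamma> i)"
    "\<phi> i x = 0 \<Longrightarrow> inner (nrm \<phi> i x) (\<gamma> i x) > 0"
proof -
  show d: "\<phi> i differentiable (at x)" and f: "frontier (Gi \<phi> i) = {x. \<phi> i x = 0}"
    and "continuous_on (frontier (Gi \<phi> i)) (\<gamma> i)" for x
    using assms by (auto simp: pw_C1_refl_def C1_fun_def)
  show "continuous_on UNIV (\<phi> i)"
    using d differentiable_imp_continuous_within by (simp add: continuous_on_eq_continuous_within) blast
  show "\<phi> i x = 0 \<Longrightarrow> grad (\<phi> i) x \<noteq> 0" "\<phi> i x = 0 \<Longrightarrow> inner (nrm \<phi> i x) (\<gamma> i x) > 0"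
    using assms f by (auto simp: pw_C1_refl_def)
qed

lemma Idx_eq:
  assumes "pw_C1_refl I \<phi> \<gamma>"
  shows "Idx I \<phi> x = {i\<in>I. \<phi> i x = 0}"
  using pw_C1_reflD(3)[OF assms] by (auto simp: Idx_def)

lemma closure_GG_nonneg:
  assumes "pw_C1_refl I \<phi> \<gamma>" "i \<in> I" "y \<in> closure (GG I \<phi>)"
  shows "0 \<le> \<phi> i y"
proof -
  have "closed {y. 0 \<le> \<phi> i y}"
    by (intro closed_Collect_le continuous_intros pw_C1_reflD(2)[OF assms(1,2)])
  moreover have "GG I \<phi> \<subseteq> {y. 0 \<le> \<phi> i y}"
    using assms(2) by (force simp: GG_def Gi_def)
  ultimately show ?thesis using closure_minimal assms(3) by blast
qed

text \<open>Each active \<open>\<gamma> i\<close> belongs to the cone of directions and is nonzero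
  because it pairs positively with its normal, so membership in \<open>Uset\<close> applies to it;
  inside the domain no constraint is active. The coefficients are exposed because the lower bounds
  for single normals are later added with these weights.\<close>

lemma positive_normal_exists:
  assumes pw: "pw_C1_refl I \<phi> \<gamma>" and U: "frontier (GG I \<phi>) - Uset I \<phi> \<gamma> \<subseteq> V"
    and z: "z \<in> closure (GG I \<phi>)" "z \<notin> V"
  obtains s where "\<And>i. i \<in> Idx I \<phi> z \<Longrightarrow> 0 \<le> s i"
    "\<And>i. i \<in> Idx I \<phi> z \<Longrightarrow> 0 < inner (\<Sum>j\<in>Idx I \<phi> z. s j *\<^sub>R nrm \<phi> j z) (\<gamma> i z)"
proof (cases "z \<in> GG I \<phi>")
  case True
  then have "Idx I \<phi> z = {}" by (auto simp: Idx_eq[OF pw] GG_def Gi_def)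
  then show ?thesis using that by simp
next
  case False
  moreover have "open (GG I \<phi>)" using pw by (simp add: pw_C1_refl_def)
  ultimately have fr: "z \<in> frontier (GG I \<phi>)" using z(1) by (simp add: frontier_def interior_open)
  then have "z \<in> Uset I \<phi> \<gamma>" using U z(2) by blast
  then obtain s where s: "\<forall>i\<in>Idx I \<phi> z. 0 \<le> s i"
    "\<forall>d\<in>dcone I \<phi> \<gamma> z - {0}. 0 < inner (\<Sum>j\<in>Idx I \<phi> z. s j *\<^sub>R nrm \<phi> j z) d"
    by (auto simp: Uset_def ncone_def)
  show ?thesis
  proof (rule that)
    show "0 \<le> s i" if "i \<in> Idx I \<phi> z" for i using s(1) that by blast
    fix i assume i: "i \<in> Idx I \<phi> z"
    have fin: "finite (Idx I \<phi> z)" using pw by (simp add: pw_C1_refl_def Idx_def)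
    have "\<gamma> i z = (\<Sum>j\<in>Idx I \<phi> z. (if j = i then 1 else 0) *\<^sub>R \<gamma> j z)"
      using i fin by (simp add: if_distrib[of "\<lambda>c. c *\<^sub>R _"] cong: if_cong)
    then have "\<gamma> i z \<in> dcone I \<phi> \<gamma> z"
      using fr unfolding dcone_def by (auto intro!: exI[of _ "\<lambda>j. if j = i then 1 else 0"])
    moreover have "\<gamma> i z \<noteq> 0"
      using pw_C1_reflD(6)[OF pw, of i z] i by (auto simp: Idx_eq[OF pw])
    ultimately show "0 < inner (\<Sum>j\<in>Idx I \<phi> z. s j *\<^sub>R nrm \<phi> j z) (\<gamma> i z)"
      using s(2) by blast
  qed
qed

text \<open>To first order \<open>\<phi> i y\<close> is the pairing of the gradient at
  \<open>z\<close> with \<open>y - z\<close>, so where it is nonnegative that pairing is at worst a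
  small negative multiple of the distance.\<close>

lemma inner_normal_lower_bound:
  assumes pw: "pw_C1_refl I \<phi> \<gamma>" and i: "i \<in> I" and z: "\<phi> i z = 0" and e: "e > 0"
  shows "\<forall>\<^sub>F y in nhds z. 0 \<le> \<phi> i y \<longrightarrow> - e * norm (y - z) \<le> inner (nrm \<phi> i z) (y - z)"
proof -
  let ?g = "grad (\<phi> i) z"
  have g: "norm ?g > 0" using pw_C1_reflD(4)[OF pw i z] by simp
  obtain f' where f': "(\<phi> i has_derivative f') (at z)"
    using pw_C1_reflD(1)[OF pw i, of z] by (auto simp: differentiable_def)
  then obtain d where d: "d > 0"
    "\<And>y. norm (y - z) < d \<Longrightarrow> norm (\<phi> i y - \<phi> i z - f' (y - z)) \<le> e * norm ?g * norm (y - z)"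
    using mult_pos_pos[OF e g] unfolding has_derivative_at_alt by blast
  have "- e * norm (y - z) \<le> inner (nrm \<phi> i z) (y - z)" if "dist y z < d" "0 \<le> \<phi> i y" for y
  proof -
    have "\<bar>\<phi> i y - inner ?g (y - z)\<bar> \<le> e * norm ?g * norm (y - z)"
      using d(2)[of y] that z inner_grad[OF f', of "y - z"] by (simp add: dist_norm inner_commute)
    then have "- (e * norm ?g * norm (y - z)) \<le> inner ?g (y - z)" using that(2) by linarith
    then show ?thesis using g by (simp add: nrm_def field_simps)
  qed
  then show ?thesis unfolding eventually_nhds_metric using d(1) by blast
qed

lemma barrier_at_nonvertex:
  assumes pw: "pw_C1_refl I \<phi> \<gamma>" and U: "frontier (GG I \<phi>) - Uset I \<phi> \<gamma> \<subseteq> V" and V: "finite V"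
    and z: "z \<in> closure (GG I \<phi>)" "z \<notin> V" and \<epsilon>: "\<epsilon> > 0"
  shows "\<exists>n \<kappa> \<rho>. 0 < \<rho> \<and> \<rho> \<le> \<epsilon> \<and> barrier_at I \<phi> \<gamma> V n \<kappa> \<rho> z"
proof -
  let ?J = "Idx I \<phi> z"
  have finI: "finite I" using pw by (simp add: pw_C1_refl_def)
  have J: "finite ?J" "?J \<subseteq> I" using finI by (auto simp: Idx_def)
  obtain s where s: "\<And>i. i \<in> ?J \<Longrightarrow> 0 \<le> s i"
    "\<And>i. i \<in> ?J \<Longrightarrow> 0 < inner (\<Sum>j\<in>?J. s j *\<^sub>R nrm \<phi> j z) (\<gamma> i z)"
    using positive_normal_exists[OF pw U z] by blast
  define n where "n = (\<Sum>j\<in>?J. s j *\<^sub>R nrm \<phi> j z)"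
  have \<gamma>0: "\<gamma> i z \<noteq> 0" if "i \<in> ?J" for i using s(2)[OF that] by auto
  \<comment> \<open>The factor 4 gives margin \<open>4 * c\<close> at \<open>z\<close>, so that
    \<open>2 * c\<close> survives at nearby points by continuity.\<close>
  obtain c where c: "c > 0" "\<And>i. i \<in> ?J \<Longrightarrow> c \<le> inner n (\<gamma> i z) / (4 * norm (\<gamma> i z))"
    using finite_positive_lower_bound[OF J(1), of "\<lambda>i. inner n (\<gamma> i z) / (4 * norm (\<gamma> i z))"]
      s(2) \<gamma>0 by (auto simp: n_def)
  \<comment> \<open>The weights add up to less than \<open>S\<close>, so errors \<open>e\<close> on
    the single normals total at most \<open>c / 4\<close>; the leading 1 keeps \<open>S\<close>
    positive when no constraint is active.\<close>
  define S where "S = 1 + (\<Sum>j\<in>?J. s j)"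
  have S: "S > 0" using s(1) by (auto simp: S_def intro!: add_pos_nonneg sum_nonneg)
  define e where "e = c / 4 / S"
  have e: "e > 0" using c S by (simp add: e_def)
  have ev1: "\<forall>\<^sub>F y in nhds z. \<forall>i\<in>?J. 0 \<le> \<phi> i y \<longrightarrow> - e * norm (y - z) \<le> inner (nrm \<phi> i z) (y - z)"
    using J inner_normal_lower_bound[OF pw _ _ e]
    by (intro eventually_ball_finite ballI) (auto simp: Idx_eq[OF pw])
  \<comment> \<open>Constraints inactive at \<open>z\<close> stay inactive nearby, so only indices
    in \<open>?J\<close> can be active there.\<close>
  have ev2: "\<forall>\<^sub>F y in nhds z. \<forall>i\<in>I - ?J. \<phi> i y \<noteq> 0"
  proof (intro eventually_ball_finite ballI)
    fix i assume i: "i \<in> I - ?J"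
    have "open {y. \<phi> i y \<noteq> 0}"
      using pw_C1_reflD(2)[OF pw, of i] i by (intro open_Collect_neq continuous_intros) auto
    then show "\<forall>\<^sub>F y in nhds z. \<phi> i y \<noteq> 0"
      using i eventually_nhds_in_open[of "{y. \<phi> i y \<noteq> 0}" z] by (auto simp: Idx_eq[OF pw])
  qed (use finI in auto)
  have ev3: "\<forall>\<^sub>F y in nhds z. \<forall>i\<in>?J. \<phi> i y = 0 \<longrightarrow> 2 * c * norm (\<gamma> i y) \<le> inner n (\<gamma> i y)"
  proof (intro eventually_ball_finite ballI J(1))
    fix i assume i: "i \<in> ?J"
    then have iI: "i \<in> I" "\<phi> i z = 0" by (auto simp: Idx_eq[OF pw])
    let ?f = "\<lambda>y. inner n (\<gamma> i y) - 2 * c * norm (\<gamma> i y)"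
    \<comment> \<open>Continuity of \<open>\<gamma> i\<close> is given on the boundary of its own
      constraint set, so the estimate is made relative to that set.\<close>
    have "continuous_on {y. \<phi> i y = 0} ?f"
      using pw_C1_reflD(3,5)[OF pw iI(1)] by (intro continuous_intros) auto
    moreover have "?f z > 0"
    proof -
      have "4 * c * norm (\<gamma> i z) \<le> inner n (\<gamma> i z)"
        using c(2)[OF i] \<gamma>0[OF i] by (simp add: field_simps)
      moreover have "2 * c * norm (\<gamma> i z) < 4 * c * norm (\<gamma> i z)" using c \<gamma>0[OF i] by simp
      ultimately show ?thesis by linarith
    qed
    ultimately obtain d where d: "d > 0"
      "\<And>y. y \<in> {y. \<phi> i y = 0} \<Longrightarrow> dist y z < d \<Longrightarrow> dist (?f y) (?f z) < ?f z"
      using iI(2) unfolding continuous_on_iff by blast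
    have "2 * c * norm (\<gamma> i y) \<le> inner n (\<gamma> i y)" if "dist y z < d" "\<phi> i y = 0" for y
      using d(2)[of y] that by (simp add: dist_real_def)
    then show "\<forall>\<^sub>F y in nhds z. \<phi> i y = 0 \<longrightarrow> 2 * c * norm (\<gamma> i y) \<le> inner n (\<gamma> i y)"
      unfolding eventually_nhds_metric using d(1) by blast
  qed
  obtain d where d: "d > 0" and near: "\<And>y. dist y z < d \<Longrightarrow>
      (\<forall>i\<in>?J. 0 \<le> \<phi> i y \<longrightarrow> - e * norm (y - z) \<le> inner (nrm \<phi> i z) (y - z)) \<and>
      (\<forall>i\<in>I - ?J. \<phi> i y \<noteq> 0) \<and>
      (\<forall>i\<in>?J. \<phi> i y = 0 \<longrightarrow> 2 * c * norm (\<gamma> i y) \<le> inner n (\<gamma> i y))"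
    using eventually_conj[OF ev1 eventually_conj[OF ev2 ev3]] unfolding eventually_nhds_metric by blast
  obtain \<rho>' where \<rho>': "\<rho>' > 0" "V \<inter> cball z \<rho>' \<subseteq> {z}"
    using finite_isolated_cball[OF V] by blast
  define \<rho> where "\<rho> = min \<epsilon> (min (d / 2) \<rho>')"
  have \<rho>: "0 < \<rho>" "\<rho> \<le> \<epsilon>" "\<rho> < d" "\<rho> \<le> \<rho>'" using d \<rho>' \<epsilon> by (auto simp: \<rho>_def)
  have "barrier_at I \<phi> \<gamma> V ((16 / (\<rho> * c)) *\<^sub>R n) (16 / (\<rho> * c) * (c / \<rho>)) \<rho> z"
  proof (rule barrier_at_normal[OF c(1) \<rho>(1)])
    show "V \<inter> cball z \<rho> \<subseteq> {z}" using \<rho>' \<rho> by auto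
    fix y assume y: "y \<in> closure (GG I \<phi>)" "norm (y - z) \<le> \<rho>"
    then have n: "dist y z < d" using \<rho> by (simp add: dist_norm)
    show "- (c / 4) * norm (y - z) \<le> inner n (y - z)"
    proof -
      have "- (c / 4) * norm (y - z) \<le> - (e * (\<Sum>j\<in>?J. s j)) * norm (y - z)"
      proof -
        have "e * (\<Sum>j\<in>?J. s j) \<le> e * S" using e by (intro mult_left_mono) (auto simp: S_def)
        also have "\<dots> = c / 4" using S by (simp add: e_def)
        finally show ?thesis by (intro mult_right_mono) auto
      qed
      also have "\<dots> = (\<Sum>j\<in>?J. s j * (- e * norm (y - z)))"
        by (simp add: sum_distrib_left sum_distrib_right sum_negf[symmetric] algebra_simps)
      also have "\<dots> \<le> (\<Sum>j\<in>?J. s j * inner (nrm \<phi> j z) (y - z))"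
      proof (intro sum_mono mult_left_mono s)
        fix j assume j: "j \<in> ?J"
        then have "0 \<le> \<phi> j y" using closure_GG_nonneg[OF pw _ y(1)] J(2) by blast
        then show "- e * norm (y - z) \<le> inner (nrm \<phi> j z) (y - z)" using near[OF n] j by blast
      qed
      also have "\<dots> = inner n (y - z)" by (simp add: n_def inner_sum_left)
      finally show ?thesis .
    qed
    show "2 * c * norm (\<gamma> i y) \<le> inner n (\<gamma> i y)" if "i \<in> Idx I \<phi> y" for i
      using that near[OF n] unfolding Idx_eq[OF pw] by blast
  qed
  then show ?thesis using \<rho> by blast
qed

lemma barrier_exists:
  assumes "pw_C1_refl I \<phi> \<gamma>" "Assumption2' I \<phi> \<gamma> \<sigma> V" "z \<in> closure (GG I \<phi>)" "\<epsilon> > 0"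
  shows "\<exists>n \<kappa> \<rho>. 0 < \<rho> \<and> \<rho> \<le> \<epsilon> \<and> barrier_at I \<phi> \<gamma> V n \<kappa> \<rho> z"
proof (cases "z \<in> V")
  case True
  then show ?thesis using barrier_at_vertex assms by blast
next
  case False
  have "frontier (GG I \<phi>) - Uset I \<phi> \<gamma> \<subseteq> V" "finite V"
    using assms(2) by (simp_all add: Assumption2'_def)
  then show ?thesis by (rule barrier_at_nonvertex[OF assms(1) _ _ assms(3) False assms(4)])
qed

section \<open>Polyhedral domains\<close>

text \<open>Just before a first return to 0 the function would be negative, because it crosses
  upward there. The intermediate value theorem would then give a still earlier zero.\<close>

lemma positive_after_upcrossing_zero:
  fixes f f' :: "real \<Rightarrow> real"
  assumes f: "\<And>t. (f has_real_derivative f' t) (at t)" and up: "\<And>t. f t = 0 \<Longrightarrow> 0 < f' t"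
    and zero: "f 0 = 0" and t: "0 < t"
  shows "0 < f t"
proof (rule ccontr)
  assume "\<not> 0 < f t"
  have cont: "continuous_on S f" for S
    using f by (meson DERIV_isCont continuous_at_imp_continuous_on)
  obtain d where d: "d > 0" "\<And>h. 0 < h \<Longrightarrow> h < d \<Longrightarrow> f 0 < f (0 + h)"
    using DERIV_pos_inc_right[OF f up[OF zero]] by blast
  \<comment> \<open>Starting where \<open>f\<close> is already positive keeps the zero at 0 out of
    \<open>?Z\<close>, so a least zero beyond it can be taken.\<close>
  define a where "a = min (d / 2) (t / 2)"
  have a: "0 < a" "a < t" "f a > 0"
    using d(1) d(2)[of a] t zero by (auto simp: a_def min_def)
  let ?Z = "{s \<in> {a..t}. f s = 0}"
  obtain x where "a \<le> x" "x \<le> t" "f x = 0"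
    using IVT2'[of f t 0 a] a \<open>\<not> 0 < f t\<close> cont by auto
  then have "?Z \<noteq> {}" by auto
  moreover have "compact ?Z"
  proof -
    have "?Z = {a..t} \<inter> {s. f s = 0}" by auto
    moreover have "closed {s. f s = 0}" by (intro closed_Collect_eq cont continuous_on_const)
    ultimately show ?thesis by (simp add: compact_Int_closed)
  qed
  ultimately obtain x where x: "x \<in> ?Z" "\<And>y. y \<in> ?Z \<Longrightarrow> x \<le> y"
    using compact_attains_inf[of ?Z] by blast
  have ax: "a < x" using x(1) a(3) by (cases "a = x") auto
  obtain d where d: "d > 0" "\<And>h. 0 < h \<Longrightarrow> h < d \<Longrightarrow> f (x - h) < f x"
    using DERIV_pos_inc_left[OF f up] x(1) by blast
  define h where "h = min (d / 2) (x - a)"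
  have h: "0 < h" "h < d" "a \<le> x - h" using d(1) ax by (auto simp: h_def min_def)
  then have "f (x - h) < 0" using d(2) x(1) by fastforce
  then obtain u where "a \<le> u" "u \<le> x - h" "f u = 0"
    using IVT2'[of f "x - h" 0 a] a h cont by auto
  then show False using x(1) x(2)[of u] h by auto
qed

text \<open>Along a line from \<open>z\<close> into the side to which \<open>\<nu>\<close> points,
  every zero is an upcrossing, so \<open>f\<close> stays positive; \<open>- f\<close> is treated
  likewise on the other side. A zero set with constant normal is therefore a whole hyperplane,
  however nonlinear \<open>f\<close> is.\<close>

lemma sign_beside_constant_normal_level:
  fixes f :: "real^'J::finite \<Rightarrow> real"
  assumes f: "\<And>x. f differentiable (at x)" and \<nu>: "\<nu> \<noteq> 0"
    and normal: "\<And>x. f x = 0 \<Longrightarrow> \<exists>c>0. grad f x = c *\<^sub>R \<nu>" and z: "f z = 0"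
  shows "f y > 0 \<longleftrightarrow> inner \<nu> y > inner \<nu> z" "f y = 0 \<longleftrightarrow> inner \<nu> y = inner \<nu> z"
proof -
  have line: "((\<lambda>t. f (z + t *\<^sub>R u)) has_real_derivative inner u (grad f (z + t *\<^sub>R u))) (at t)" for u t
  proof -
    let ?x = "z + t *\<^sub>R u"
    obtain f' where f': "(f has_derivative f') (at ?x)" using f differentiable_def by blast
    interpret linear f' using f' has_derivative_linear by blast
    have "((\<lambda>t. z + t *\<^sub>R u) has_derivative (\<lambda>h. h *\<^sub>R u)) (at t)"
      by (auto intro!: derivative_eq_intros)
    from has_derivative_compose[OF this f']
    have "((\<lambda>t. f (z + t *\<^sub>R u)) has_derivative (\<lambda>h. f' (h *\<^sub>R u))) (at t)" .
    moreover have "(\<lambda>h. f' (h *\<^sub>R u)) = (*) (f' u)" by (auto simp: scale)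
    ultimately show ?thesis
      unfolding has_field_derivative_def inner_grad[OF f'] by simp
  qed
  have pos: "f y > 0" if "inner \<nu> y > inner \<nu> z" for y
  proof -
    have "0 < (\<lambda>t. f (z + t *\<^sub>R (y - z))) 1"
    proof (rule positive_after_upcrossing_zero[OF line])
      fix t assume "f (z + t *\<^sub>R (y - z)) = 0"
      then obtain c where "c > 0" "grad f (z + t *\<^sub>R (y - z)) = c *\<^sub>R \<nu>" using normal by blast
      then show "0 < inner (y - z) (grad f (z + t *\<^sub>R (y - z)))"
        using that by (simp add: inner_commute[of "y - z"] inner_diff_right)
    qed (use z in auto)
    then show ?thesis by simp
  qed
  have neg: "f y < 0" if "inner \<nu> y < inner \<nu> z" for y
  proof -
    \<comment> \<open>This path starts at \<open>z\<close> and reaches \<open>y\<close> at time 1;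
      at its zeros the derivative is positive because \<open>z - y\<close> pairs positively with
      \<open>\<nu>\<close>.\<close>
    have D: "((\<lambda>t. - f (z + (- t) *\<^sub>R (z - y))) has_real_derivative
        inner (z - y) (grad f (z + (- t) *\<^sub>R (z - y)))) (at t)" for t
      using DERIV_minus[OF DERIV_chain2[OF line DERIV_minus[OF DERIV_ident]], of "z - y" t] by simp
    have "0 < (\<lambda>t. - f (z + (- t) *\<^sub>R (z - y))) 1"
    proof (rule positive_after_upcrossing_zero[OF D])
      fix t assume "- f (z + (- t) *\<^sub>R (z - y)) = 0"
      then have "f (z + (- t) *\<^sub>R (z - y)) = 0" by simp
      then obtain c where "c > 0" "grad f (z + (- t) *\<^sub>R (z - y)) = c *\<^sub>R \<nu>" using normal by blast
      then show "0 < inner (z - y) (grad f (z + (- t) *\<^sub>R (z - y)))"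
        using that by (simp add: inner_commute[of "z - y"] inner_diff_right)
    qed (use z in auto)
    then show ?thesis by simp
  qed
  \<comment> \<open>A point of the hyperplane is approached along \<open>\<nu>\<close> from both
    sides, where the signs are known, and continuity forces the value 0.\<close>
  have eq: "f y = 0" if "inner \<nu> y = inner \<nu> z" for y
  proof -
    have \<nu>2: "inner \<nu> \<nu> > 0" using \<nu> by simp
    have lim: "((\<lambda>t::real. f (y + t *\<^sub>R \<nu>)) \<longlongrightarrow> f (y + 0 *\<^sub>R \<nu>)) (at 0 within S)" for S
    proof (rule isCont_tendsto_compose[of _ f])
      show "isCont f (y + 0 *\<^sub>R \<nu>)" using f differentiable_imp_continuous_within by blast
    qed (intro tendsto_intros)
    have "0 \<le> f (y + 0 *\<^sub>R \<nu>)"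
    proof (rule tendsto_lowerbound[OF lim[of "{0<..}"]])
      show "\<forall>\<^sub>F t in at_right 0. 0 \<le> f (y + t *\<^sub>R \<nu>)"
        using eventually_at_right_less[of "0::real"]
        by eventually_elim (use that \<nu>2 in \<open>auto intro!: less_imp_le pos simp: inner_add_right\<close>)
    qed simp
    moreover have "f (y + 0 *\<^sub>R \<nu>) \<le> 0"
    proof (rule tendsto_upperbound[OF lim[of "{..<0}"]])
      show "\<forall>\<^sub>F t in at_left 0. f (y + t *\<^sub>R \<nu>) \<le> 0"
        unfolding eventually_at_filter
        by (rule always_eventually) (use that \<nu>2 in \<open>auto intro!: less_imp_le neg mult_neg_pos simp: inner_add_right\<close>)
    qed simp
    ultimately show ?thesis by simp
  qed
  show "f y > 0 \<longleftrightarrow> inner \<nu> y > inner \<nu> z" "f y = 0 \<longleftrightarrow> inner \<nu> y = inner \<nu> z"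
    using pos[of y] neg[of y] eq[of y] by linarith+
qed

text \<open>Constant normals are imposed only on the zero sets of the \<open>\<phi> i\<close>. This
  translates the domain, its active sets and its reflection into linear inequalities, so that
  distances to faces can be compared at remote points.\<close>

lemma polyhedral_halfspaces:
  fixes \<phi> :: "'i \<Rightarrow> real^'J::finite \<Rightarrow> real"
  assumes poly: "polyhedral_refl I \<phi> \<gamma>"
  shows "\<exists>I' \<nu> \<beta> g. I' \<subseteq> I \<and> (\<forall>i\<in>I'. norm (\<nu> i) = 1)
    \<and> (\<forall>x. x \<in> closure (GG I \<phi>) \<longleftrightarrow> (\<forall>i\<in>I'. \<beta> i \<le> inner (\<nu> i) x))
    \<and> (\<forall>x. Idx I \<phi> x = {i\<in>I'. inner (\<nu> i) x = \<beta> i})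
    \<and> (\<forall>x. \<forall>i\<in>Idx I \<phi> x. nrm \<phi> i x = \<nu> i \<and> \<gamma> i x = g i)"
proof -
  have pw: "pw_C1_refl I \<phi> \<gamma>" using poly by (simp add: polyhedral_refl_def)
  have "\<forall>i\<in>I. \<exists>\<nu>. \<forall>x. \<phi> i x = 0 \<longrightarrow> nrm \<phi> i x = \<nu>" "\<forall>i\<in>I. \<exists>g. \<forall>x. \<phi> i x = 0 \<longrightarrow> \<gamma> i x = g"
    using poly pw_C1_reflD(3)[OF pw] by (auto simp: polyhedral_refl_def)
  then obtain \<nu> g where \<nu>: "\<And>i x. i \<in> I \<Longrightarrow> \<phi> i x = 0 \<Longrightarrow> nrm \<phi> i x = \<nu> i"
    and g: "\<And>i x. i \<in> I \<Longrightarrow> \<phi> i x = 0 \<Longrightarrow> \<gamma> i x = g i" by metis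
  \<comment> \<open>A constraint without zeros has empty frontier, so its set is the whole space and
    cuts nothing off; it also offers no base point from which to define
    \<open>\<beta> i\<close>.\<close>
  define I' where "I' = {i\<in>I. \<exists>x. \<phi> i x = 0}"
  then have "\<forall>i\<in>I'. \<exists>x. \<phi> i x = 0" by blast
  then obtain p where p: "\<And>i. i \<in> I' \<Longrightarrow> \<phi> i (p i) = 0" by metis
  have I': "i \<in> I" if "i \<in> I'" for i using that by (simp add: I'_def)
  have n1: "norm (\<nu> i) = 1" if "i \<in> I'" for i
  proof -
    have "norm (nrm \<phi> i (p i)) = 1"
      using pw_C1_reflD(4)[OF pw I'[OF that] p[OF that]] by (simp add: nrm_def)
    then show ?thesis using \<nu>[OF I'[OF that] p[OF that]] by simp
  qed
  define \<beta> where "\<beta> i = inner (\<nu> i) (p i)" for i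
  have sign: "\<phi> i y > 0 \<longleftrightarrow> inner (\<nu> i) y > \<beta> i" "\<phi> i y = 0 \<longleftrightarrow> inner (\<nu> i) y = \<beta> i" if i: "i \<in> I'" for i y
  proof -
    have normal: "\<exists>c>0. grad (\<phi> i) x = c *\<^sub>R \<nu> i" if x: "\<phi> i x = 0" for x
    proof -
      have "norm (grad (\<phi> i) x) > 0" using pw_C1_reflD(4)[OF pw I'[OF i] x] by simp
      moreover have "\<nu> i = (1 / norm (grad (\<phi> i) x)) *\<^sub>R grad (\<phi> i) x"
        using \<nu>[OF I'[OF i] x] by (simp add: nrm_def)
      ultimately show ?thesis
        by (intro exI[of _ "norm (grad (\<phi> i) x)"]) auto
    qed
    have "\<nu> i \<noteq> 0" using n1[OF i] by auto
    note * = sign_beside_constant_normal_level[OF pw_C1_reflD(1)[OF pw I'[OF i]] this normal p[OF i]]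
    show "\<phi> i y > 0 \<longleftrightarrow> inner (\<nu> i) y > \<beta> i" "\<phi> i y = 0 \<longleftrightarrow> inner (\<nu> i) y = \<beta> i"
      unfolding \<beta>_def by (rule *; assumption)+
  qed
  obtain q where q: "q \<in> GG I \<phi>" using pw by (auto simp: pw_C1_refl_def)
  have rest: "\<phi> i y > 0" if i: "i \<in> I" "i \<notin> I'" for i y
  proof -
    have "frontier (Gi \<phi> i) = {}" using pw_C1_reflD(3)[OF pw i(1)] i by (auto simp: I'_def)
    moreover have "Gi \<phi> i \<noteq> {}" using q i(1) by (auto simp: GG_def)
    ultimately have "Gi \<phi> i = UNIV" using frontier_eq_empty by blast
    then show ?thesis by (auto simp: Gi_def)
  qed
  have GG: "x \<in> GG I \<phi> \<longleftrightarrow> (\<forall>i\<in>I'. \<beta> i < inner (\<nu> i) x)" for x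
    unfolding GG_def Gi_def using sign(1)[of _ x] rest[of _ x] I' by blast
  have cl: "x \<in> closure (GG I \<phi>) \<longleftrightarrow> (\<forall>i\<in>I'. \<beta> i \<le> inner (\<nu> i) x)" for x
  proof
    assume x: "x \<in> closure (GG I \<phi>)"
    show "\<forall>i\<in>I'. \<beta> i \<le> inner (\<nu> i) x"
    proof
      fix i assume i: "i \<in> I'"
      show "\<beta> i \<le> inner (\<nu> i) x"
        using closure_GG_nonneg[OF pw I'[OF i] x] sign[OF i, of x] by linarith
    qed
  next
    assume x: "\<forall>i\<in>I'. \<beta> i \<le> inner (\<nu> i) x"
    \<comment> \<open>The segment from \<open>x\<close> towards the interior point \<open>q\<close>
      satisfies all inequalities strictly as soon as it leaves \<open>x\<close>.\<close>
    have "((\<lambda>t::real. x + t *\<^sub>R (q - x)) \<longlongrightarrow> x + 0 *\<^sub>R (q - x)) (at_right 0)"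
      by (intro tendsto_intros)
    moreover have "\<forall>\<^sub>F t in at_right 0. x + t *\<^sub>R (q - x) \<in> GG I \<phi>"
      unfolding eventually_at_right_field
    proof (intro exI[of _ 1] conjI allI impI)
      fix t :: real assume t: "0 < t" "t < 1"
      show "x + t *\<^sub>R (q - x) \<in> GG I \<phi>"
        unfolding GG
      proof
        fix i assume i: "i \<in> I'"
        have "0 < t * (inner (\<nu> i) q - \<beta> i)" using q i t by (simp add: GG)
        moreover have "0 \<le> (1 - t) * (inner (\<nu> i) x - \<beta> i)" using x i t by simp
        ultimately show "\<beta> i < inner (\<nu> i) (x + t *\<^sub>R (q - x))"
          by (simp add: inner_add_right inner_diff_right algebra_simps)
      qed
    qed simp
    then have "\<forall>\<^sub>F t in at_right 0. x + t *\<^sub>R (q - x) \<in> closure (GG I \<phi>)"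
      by (rule eventually_mono) (use closure_subset in blast)
    ultimately have "x + 0 *\<^sub>R (q - x) \<in> closure (GG I \<phi>)"
      by (intro Lim_in_closed_set[OF closed_closure]) auto
    then show "x \<in> closure (GG I \<phi>)" by simp
  qed
  have idx: "Idx I \<phi> x = {i\<in>I'. inner (\<nu> i) x = \<beta> i}" for x
    using sign(2) by (auto simp: Idx_eq[OF pw] I'_def)
  have const: "nrm \<phi> i x = \<nu> i \<and> \<gamma> i x = g i" if "i \<in> Idx I \<phi> x" for i x
    using that \<nu> g by (auto simp: Idx_eq[OF pw])
  show ?thesis
    by (rule exI[of _ I'], rule exI[of _ \<nu>], rule exI[of _ \<beta>], rule exI[of _ g])
      (use I' n1 cl idx const in blast)
qed

section \<open>Sequences running to infinity in a polyhedral domain\<close>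

text \<open>Indices are treated one at a time, both alternatives being inherited by subsequences. If
  infinitely many terms lie under one bound, compactness of an interval gives convergence; otherwise
  every bound is eventually exceeded.\<close>

lemma convergent_or_divergent_subsequence:
  fixes a :: "'i \<Rightarrow> nat \<Rightarrow> real"
  assumes "finite S" "\<And>i k. i \<in> S \<Longrightarrow> 0 \<le> a i k"
  shows "\<exists>s. strict_mono s \<and>
    (\<forall>i\<in>S. convergent (a i \<circ> s) \<or> filterlim (a i \<circ> s) at_top sequentially)"
  using assms
proof (induction S rule: finite_induct)
  case empty
  then show ?case using strict_mono_id by auto
next
  case (insert x S)
  then obtain s where s: "strict_mono s"
    and S: "\<forall>i\<in>S. convergent (a i \<circ> s) \<or> filterlim (a i \<circ> s) at_top sequentially" by blast
  let ?b = "a x \<circ> s"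
  have "\<exists>r. strict_mono r \<and> (convergent (?b \<circ> r) \<or> filterlim (?b \<circ> r) at_top sequentially)"
  proof (cases "\<exists>B. infinite {k. ?b k \<le> B}")
    case True
    then obtain B where "infinite {k. ?b k \<le> B}" by blast
    then obtain r :: "nat \<Rightarrow> nat" where r: "strict_mono r" "\<And>k. ?b (r k) \<le> B"
      using infinite_enumerate by blast
    have "\<forall>k. (?b \<circ> r) k \<in> {0..B}" using r(2) insert.prems by auto
    then obtain l r' where r': "strict_mono r'" "((?b \<circ> r) \<circ> r') \<longlonglongrightarrow> l"
      using compact_Icc[of 0 B] unfolding compact_def by blast
    have "convergent (?b \<circ> (r \<circ> r'))"
      using r'(2) by (auto simp: convergent_def comp_assoc)
    then show ?thesis using strict_mono_o[OF r(1) r'(1)] by blast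
  next
    case False
    have "\<forall>\<^sub>F k in sequentially. Z \<le> ?b k" for Z
      using False unfolding cofinite_eq_sequentially[symmetric] eventually_cofinite
      by (metis (mono_tags, lifting) Collect_mono finite_subset nle_le)
    then have "filterlim ?b at_top sequentially" by (simp add: filterlim_at_top)
    then show ?thesis using strict_mono_id by (intro exI[of _ id]) auto
  qed
  then obtain r where r: "strict_mono r" "convergent (?b \<circ> r) \<or> filterlim (?b \<circ> r) at_top sequentially"
    by blast
  have "convergent (a i \<circ> (s \<circ> r)) \<or> filterlim (a i \<circ> (s \<circ> r)) at_top sequentially" if "i \<in> insert x S" for i
  proof (cases "i = x")
    case True
    then show ?thesis using r(2) by (simp add: comp_assoc)
  next
    case False
    then have "convergent (a i \<circ> s) \<or> filterlim (a i \<circ> s) at_top sequentially" using S that by blast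
    then show ?thesis
      using convergent_subseq_convergent[OF _ r(1), of "a i \<circ> s"]
        filterlim_compose[OF _ filterlim_subseq[OF r(1)], of "a i \<circ> s" at_top]
      by (auto simp: comp_def)
  qed
  then show ?case using strict_mono_o[OF s r(1)] by blast
qed

text \<open>Only the orthogonal projections of the points onto the span of \<open>W\<close> matter, and these converge.\<close>

lemma vanishing_correction:
  fixes y :: "nat \<Rightarrow> 'a::euclidean_space"
  assumes conv: "\<And>w. w \<in> W \<Longrightarrow> convergent (\<lambda>k. inner w (y k))"
  obtains e where "e \<longlonglongrightarrow> 0" "\<And>w k. w \<in> W \<Longrightarrow> inner w (y k + e k) = lim (\<lambda>k. inner w (y k))"
proof -
  have "\<exists>p. p \<in> span W \<and> (\<forall>w\<in>span W. inner w (x - p) = 0)" for x :: 'a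
  proof -
    obtain p q where "p \<in> span W" "\<And>w. w \<in> span W \<Longrightarrow> orthogonal q w" "x = p + q"
      using orthogonal_subspace_decomp_exists[of W x] by blast
    then show ?thesis by (intro exI[of _ p]) (auto simp: orthogonal_def inner_commute)
  qed
  then obtain P where P: "\<And>x. P x \<in> span W" "\<And>x w. w \<in> span W \<Longrightarrow> inner w (x - P x) = 0" by metis
  have cs: "convergent (\<lambda>k. inner w (y k))" if "w \<in> span W" for w
    using that
  proof (induction rule: span_induct_alt)
    case base
    then show ?case by (simp add: convergent_const)
  next
    case (step c x z)
    then show ?case
      by (simp add: inner_add_left convergent_add convergent_mult convergent_const conv)
  qed
  have cP: "convergent (\<lambda>k. inner b (P (y k)))" for b
  proof -
    \<comment> \<open>The projection is self-adjoint, so the coordinates of \<open>P (y k)\<close>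
      are pairings of \<open>y k\<close> with vectors of the span, and these converge.\<close>
    have "inner b (P (y k)) = inner (P b) (y k)" for k
      using P(2)[OF P(1)[of "y k"], of b] P(2)[OF P(1)[of b], of "y k"]
      by (simp add: inner_diff_right inner_commute)
    then show ?thesis using cs[OF P(1)[of b]] by simp
  qed
  then obtain l where l: "\<And>b. (\<lambda>k. inner b (P (y k))) \<longlonglongrightarrow> l b"
    unfolding convergent_def by metis
  define p where "p = (\<Sum>b\<in>Basis. l b *\<^sub>R b)"
  have "(\<lambda>k. \<Sum>b\<in>Basis. inner b (P (y k)) *\<^sub>R b) \<longlonglongrightarrow> p"
    unfolding p_def by (intro tendsto_intros l)
  then have p: "(\<lambda>k. P (y k)) \<longlonglongrightarrow> p"
    by (simp add: inner_commute[of _ "P _"] euclidean_representation)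
  show ?thesis
  \<comment> \<open>The correction replaces the projection of \<open>y k\<close> by its limit and
    leaves the component orthogonal to the span alone.\<close>
  proof (rule that[of "\<lambda>k. p - P (y k)"])
    show "(\<lambda>k. p - P (y k)) \<longlonglongrightarrow> 0"
      using tendsto_diff[OF tendsto_const p, of p] by simp
    fix w k assume w: "w \<in> W"
    have e: "inner w (P (y k)) = inner w (y k)" for k
      using P(2)[OF span_base[OF w], of "y k"] by (simp add: inner_diff_right)
    have "(\<lambda>k. inner w (P (y k))) \<longlonglongrightarrow> inner w p" by (intro tendsto_intros p)
    then have "lim (\<lambda>k. inner w (y k)) = inner w p" unfolding e by (rule limI)
    then show "inner w (y k + (p - P (y k))) = lim (\<lambda>k. inner w (y k))"
      by (simp add: inner_add_right inner_diff_right e)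
  qed
qed

text \<open>The corrected points eventually share the active set \<open>J\<close>, and all other
  slacks stay at least \<open>min m 1\<close>. With constant normals and directions, the vector
  found at a single corrected point then serves at all later ones, far away from
  \<open>V\<close>.\<close>

lemma polyhedral_barriers_at_infinity:
  fixes \<phi> :: "'i \<Rightarrow> real^'J::finite \<Rightarrow> real"
  assumes poly: "polyhedral_refl I \<phi> \<gamma>" and V: "finite V"
    and U: "frontier (GG I \<phi>) - Uset I \<phi> \<gamma> \<subseteq> V" and \<epsilon>: "\<epsilon> > 0"
    and y: "\<And>k. y k \<in> closure (GG I \<phi>)" and inf: "filterlim (\<lambda>k. norm (y k)) at_top sequentially"
  shows "\<exists>n \<kappa> \<rho>. 0 < \<rho> \<and> \<rho> \<le> \<epsilon> \<and>
    (\<forall>\<eta>>0. \<forall>K. \<exists>k\<ge>K. \<exists>z. dist z (y k) < \<eta> \<and> barrier_at I \<phi> \<gamma> V n \<kappa> \<rho> z)"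
proof -
  have pw: "pw_C1_refl I \<phi> \<gamma>" using poly by (simp add: polyhedral_refl_def)
  obtain I' \<nu> \<beta> g where I': "I' \<subseteq> I" and n1: "\<forall>i\<in>I'. norm (\<nu> i) = 1"
    and cl: "\<forall>x. x \<in> closure (GG I \<phi>) \<longleftrightarrow> (\<forall>i\<in>I'. \<beta> i \<le> inner (\<nu> i) x)"
    and idx: "\<forall>x. Idx I \<phi> x = {i\<in>I'. inner (\<nu> i) x = \<beta> i}"
    and ng: "\<forall>x. \<forall>i\<in>Idx I \<phi> x. nrm \<phi> i x = \<nu> i \<and> \<gamma> i x = g i"
    using polyhedral_halfspaces[OF poly] by blast
  note n1 = n1[rule_format] and cl = cl[rule_format] and idx = idx[rule_format]
    and nrm = ng[rule_format, THEN conjunct1] and g = ng[rule_format, THEN conjunct2]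
  have finI': "finite I'" using I' pw finite_subset by (auto simp: pw_C1_refl_def)
  define a where "a i k = inner (\<nu> i) (y k) - \<beta> i" for i k
  have a0: "0 \<le> a i k" if "i \<in> I'" for i k using y[of k] that by (simp add: cl a_def)
  obtain s where s: "strict_mono s"
    and dich: "\<And>i. i \<in> I' \<Longrightarrow> convergent (a i \<circ> s) \<or> filterlim (a i \<circ> s) at_top sequentially"
    using convergent_or_divergent_subsequence[OF finI', of a] a0 by blast
  define B where "B = {i\<in>I'. convergent (a i \<circ> s)}"
  have conv: "convergent (\<lambda>k. inner w (y (s k)))" if w: "w \<in> \<nu> ` B" for w
  proof -
    obtain i where i: "i \<in> B" "w = \<nu> i" using w by blast
    then have "convergent (\<lambda>k. (a i \<circ> s) k + \<beta> i)"
      by (intro convergent_add convergent_const) (simp add: B_def comp_def)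
    then show ?thesis by (simp add: a_def i)
  qed
  obtain e where e: "e \<longlonglongrightarrow> 0"
    and ve: "\<And>w k. w \<in> \<nu> ` B \<Longrightarrow> inner w (y (s k) + e k) = lim (\<lambda>k. inner w (y (s k)))"
    using vanishing_correction[of "\<nu> ` B" "\<lambda>k. y (s k)", OF conv] by blast
  define x where "x k = y (s k) + e k" for k
  define l where "l i = lim (\<lambda>k. inner (\<nu> i) (y (s k))) - \<beta> i" for i
  have xB: "inner (\<nu> i) (x k) - \<beta> i = l i" if "i \<in> B" for i k
    using ve[of "\<nu> i" k] that by (simp add: x_def l_def)
  have l0: "0 \<le> l i" if i: "i \<in> B" for i
  proof -
    have "(\<lambda>k. inner (\<nu> i) (y (s k))) \<longlonglongrightarrow> lim (\<lambda>k. inner (\<nu> i) (y (s k)))"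
      using conv[of "\<nu> i"] i convergent_LIMSEQ_iff by blast
    moreover have "\<beta> i \<le> inner (\<nu> i) (y (s k))" for k
      using a0[of i "s k"] i by (simp add: a_def B_def)
    ultimately have "\<beta> i \<le> lim (\<lambda>k. inner (\<nu> i) (y (s k)))"
      by (intro LIMSEQ_le_const) auto
    then show ?thesis by (simp add: l_def)
  qed
  have e1: "\<forall>\<^sub>F k in sequentially. norm (e k) < \<eta>" if "\<eta> > 0" for \<eta>
    using tendstoD[OF e that] by (simp add: dist_norm)
  \<comment> \<open>Divergent slacks eventually reach 2 along the sequence, and the correction costs
    at most 1 because the normals are unit vectors.\<close>
  have ev1: "\<forall>\<^sub>F k in sequentially. \<forall>i\<in>I' - B. 1 \<le> inner (\<nu> i) (x k) - \<beta> i"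
  proof (intro eventually_ball_finite ballI)
    fix i assume i: "i \<in> I' - B"
    then have "filterlim (a i \<circ> s) at_top sequentially" using dich by (auto simp: B_def)
    then have "\<forall>\<^sub>F k in sequentially. 2 \<le> a i (s k)" by (simp add: filterlim_at_top)
    then show "\<forall>\<^sub>F k in sequentially. 1 \<le> inner (\<nu> i) (x k) - \<beta> i"
      using e1[OF zero_less_one]
    proof eventually_elim
      case (elim k)
      have "\<bar>inner (\<nu> i) (e k)\<bar> \<le> 1"
        using Cauchy_Schwarz_ineq2[of "\<nu> i" "e k"] n1[of i] i elim(2) by simp
      then show ?case using elim(1) by (simp add: a_def x_def inner_add_right)
    qed
  qed (use finI' in auto)
  have ev2: "\<forall>\<^sub>F k in sequentially. \<forall>v\<in>V. 1 < dist (x k) v"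
  proof (intro eventually_ball_finite ballI V)
    fix v :: "real^'J"
    have "filterlim (\<lambda>k. norm (y (s k))) at_top sequentially"
      by (rule filterlim_compose[OF inf filterlim_subseq[OF s]])
    then have "\<forall>\<^sub>F k in sequentially. norm v + 2 < norm (y (s k))" by (simp add: filterlim_at_top_dense)
    then show "\<forall>\<^sub>F k in sequentially. 1 < dist (x k) v"
      using e1[OF zero_less_one]
    proof eventually_elim
      case (elim k)
      have "norm (y (s k)) \<le> norm (x k - v) + norm v + norm (e k)"
        using norm_triangle_ineq[of "x k - v" v] norm_triangle_ineq4[of "x k" "e k"]
        by (simp add: x_def)
      then show ?case using elim by (simp add: dist_norm)
    qed
  qed
  obtain K0 where K0: "\<And>k i. k \<ge> K0 \<Longrightarrow> i \<in> I' - B \<Longrightarrow> 1 \<le> inner (\<nu> i) (x k) - \<beta> i"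
    "\<And>k v. k \<ge> K0 \<Longrightarrow> v \<in> V \<Longrightarrow> 1 < dist (x k) v"
    using eventually_conj[OF ev1 ev2] unfolding eventually_sequentially by blast
  define J where "J = {i\<in>B. l i = 0}"
  have J: "J \<subseteq> B" "B \<subseteq> I'" "finite J" using finI' by (auto simp: J_def B_def)
  have "finite (B - J)" using finI' J(2) finite_subset by blast
  moreover have "0 < l i" if "i \<in> B - J" for i using l0[of i] that by (auto simp: J_def)
  ultimately obtain m where m: "m > 0" "\<And>i. i \<in> B - J \<Longrightarrow> m \<le> l i"
    using finite_positive_lower_bound[of "B - J" l] by blast
  have slack: "min m 1 \<le> inner (\<nu> i) (x k) - \<beta> i" if "k \<ge> K0" "i \<in> I' - J" for i k
    using that K0(1)[OF that(1), of i] m(2)[of i] xB[of i k] by (cases "i \<in> B") auto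
  have xJ: "inner (\<nu> i) (x k) = \<beta> i" if "i \<in> J" for i k
    using xB[of i k] that by (simp add: J_def)
  have xG: "x k \<in> closure (GG I \<phi>)" if "k \<ge> K0" for k
    unfolding cl
  proof
    fix i assume "i \<in> I'"
    then show "\<beta> i \<le> inner (\<nu> i) (x k)"
      using slack[OF that, of i] xJ[of i k] m(1) by (cases "i \<in> J") auto
  qed
  have xJ': "Idx I \<phi> (x k) = J" if "k \<ge> K0" for k
  proof -
    have "inner (\<nu> i) (x k) \<noteq> \<beta> i" if "i \<in> I' - J" for i
      using slack[OF \<open>k \<ge> K0\<close> that] m(1) by auto
    then show ?thesis using xJ J unfolding idx by blast
  qed
  have "x K0 \<notin> V" using K0(2)[of K0 "x K0"] by auto
  then obtain t where t: "\<And>i. i \<in> Idx I \<phi> (x K0) \<Longrightarrow> 0 \<le> t i"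
    "\<And>i. i \<in> Idx I \<phi> (x K0) \<Longrightarrow>
       0 < inner (\<Sum>j\<in>Idx I \<phi> (x K0). t j *\<^sub>R nrm \<phi> j (x K0)) (\<gamma> i (x K0))"
    using positive_normal_exists[OF pw U xG[OF order_refl]] by blast
  define n where "n = (\<Sum>j\<in>J. t j *\<^sub>R \<nu> j)"
  have "(\<Sum>j\<in>Idx I \<phi> (x K0). t j *\<^sub>R nrm \<phi> j (x K0)) = n"
    unfolding n_def using xJ'[OF order_refl] nrm by (intro sum.cong) auto
  then have ng: "0 < inner n (g i)" if "i \<in> J" for i
    using t(2)[of i] g[of i "x K0"] that xJ'[OF order_refl] by simp
  have t0: "0 \<le> t i" if "i \<in> J" for i using t(1) that xJ'[OF order_refl] by blast
  have g0: "g i \<noteq> 0" if "i \<in> J" for i using ng[OF that] by auto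
  \<comment> \<open>The factor is 2 here, where the piecewise C1 case has 4: the directions are
    constant, so no margin is lost by moving away from the centre.\<close>
  obtain c where c: "c > 0" "\<And>i. i \<in> J \<Longrightarrow> c \<le> inner n (g i) / (2 * norm (g i))"
    using finite_positive_lower_bound[OF J(3), of "\<lambda>i. inner n (g i) / (2 * norm (g i))"] ng g0
    by auto
  \<comment> \<open>Strictly below \<open>min m 1\<close>, so a constraint inactive at
    \<open>x k\<close> cannot become active within distance \<open>\<rho>\<close>.\<close>
  define \<rho> where "\<rho> = min \<epsilon> (min m 1 / 2)"
  have \<rho>: "0 < \<rho>" "\<rho> \<le> \<epsilon>" "\<rho> < min m 1" using \<epsilon> m(1) by (auto simp: \<rho>_def min_def)
  have bar: "barrier_at I \<phi> \<gamma> V ((16 / (\<rho> * c)) *\<^sub>R n) (16 / (\<rho> * c) * (c / \<rho>)) \<rho> (x k)"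
    if k: "k \<ge> K0" for k
  proof (rule barrier_at_normal[OF c(1) \<rho>(1)])
    show "V \<inter> cball (x k) \<rho> \<subseteq> {x k}" using K0(2)[OF k] \<rho>(3) by force
    fix u assume u: "u \<in> closure (GG I \<phi>)" "norm (u - x k) \<le> \<rho>"
    \<comment> \<open>Constraints in \<open>J\<close> are tight at \<open>x k\<close> and linear, so
      this pairing is nonnegative without any first-order error.\<close>
    have "0 \<le> (\<Sum>j\<in>J. t j * inner (\<nu> j) (u - x k))"
      using t0 u(1) J xJ by (intro sum_nonneg mult_nonneg_nonneg) (auto simp: cl inner_diff_right)
    then have "0 \<le> inner n (u - x k)" by (simp add: n_def inner_sum_left)
    moreover have "- (c / 4) * norm (u - x k) \<le> 0" using c(1) by simp
    ultimately show "- (c / 4) * norm (u - x k) \<le> inner n (u - x k)" by linarith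
    fix i assume i: "i \<in> Idx I \<phi> u"
    have "i \<in> J"
    proof (rule ccontr)
      assume "i \<notin> J"
      then have "min m 1 \<le> inner (\<nu> i) (x k) - \<beta> i" using slack[OF k] i by (simp add: idx)
      also have "\<dots> = - inner (\<nu> i) (u - x k)" using i by (simp add: idx inner_diff_right)
      also have "\<dots> \<le> norm (u - x k)"
        using Cauchy_Schwarz_ineq2[of "\<nu> i" "u - x k"] n1[of i] i by (simp add: idx)
      finally show False using u(2) \<rho>(3) by linarith
    qed
    then show "2 * c * norm (\<gamma> i u) \<le> inner n (\<gamma> i u)"
      using c(2) g0 g[OF i] by (force simp: field_simps)
  qed
  have "\<exists>k\<ge>K. \<exists>z. dist z (y k) < \<eta> \<and> barrier_at I \<phi> \<gamma> V ((16 / (\<rho> * c)) *\<^sub>R n) (16 / (\<rho> * c) * (c / \<rho>)) \<rho> z"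
    if \<eta>: "\<eta> > 0" for \<eta> K
  proof -
    obtain K1 where K1: "\<And>k. k \<ge> K1 \<Longrightarrow> norm (e k) < \<eta>"
      using e1[OF \<eta>] unfolding eventually_sequentially by blast
    define k where "k = max K (max K0 K1)"
    have "K \<le> s k" using seq_suble[OF s, of k] by (simp add: k_def)
    moreover have "dist (x k) (y (s k)) < \<eta>" using K1[of k] by (simp add: dist_norm x_def k_def)
    moreover have "k \<ge> K0" by (simp add: k_def)
    ultimately show ?thesis using bar by blast
  qed
  then show ?thesis using \<rho> by blast
qed

section \<open>Bounded and escaping sequences, and the two assumptions\<close>

text \<open>If infinitely many points stay bounded, the barrier at an accumulation point, kept at
  its own centre, lies arbitrarily close to infinitely many of them. Otherwise the norms tend to
  infinity, the domain is unbounded, and the polyhedral alternative must hold.\<close>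

lemma sequential_barriers:
  fixes \<phi> :: "'i \<Rightarrow> real^'J::finite \<Rightarrow> real"
  assumes dom: "(pw_C1_refl I \<phi> \<gamma> \<and> bounded (GG I \<phi>)) \<or> polyhedral_refl I \<phi> \<gamma>"
    and A2: "Assumption2' I \<phi> \<gamma> \<sigma> V" and \<epsilon>: "\<epsilon> > 0" and y: "\<And>k::nat. y k \<in> closure (GG I \<phi>)"
  shows "\<exists>n \<kappa> \<rho>. 0 < \<rho> \<and> \<rho> \<le> \<epsilon> \<and>
    (\<forall>\<eta>>0. \<forall>K. \<exists>k\<ge>K. \<exists>z. dist z (y k) < \<eta> \<and> barrier_at I \<phi> \<gamma> V n \<kappa> \<rho> z)"
proof (cases "\<exists>R. infinite {k. norm (y k) \<le> R}")
  case True
  then obtain R r where r: "strict_mono (r :: nat \<Rightarrow> nat)" "\<And>k. norm (y (r k)) \<le> R"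
    using infinite_enumerate by blast
  then have "\<forall>k. (y \<circ> r) k \<in> cball 0 R" by simp
  then obtain z q where q: "strict_mono (q :: nat \<Rightarrow> nat)" "((y \<circ> r) \<circ> q) \<longlonglongrightarrow> z"
    using compact_cball[of "0 :: real^'J" R] unfolding compact_def by blast
  have "z \<in> closure (GG I \<phi>)"
    using closed_sequentially[OF closed_closure _ q(2)] y by simp
  moreover have "pw_C1_refl I \<phi> \<gamma>" using dom by (auto simp: polyhedral_refl_def)
  ultimately obtain n \<kappa> \<rho> where *: "0 < \<rho>" "\<rho> \<le> \<epsilon>" "barrier_at I \<phi> \<gamma> V n \<kappa> \<rho> z"
    using barrier_exists[OF _ A2 _ \<epsilon>] by blast
  have "\<exists>k\<ge>K. dist z (y k) < \<eta>" if \<eta>: "\<eta> > 0" for \<eta> K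
  proof -
    obtain k0 where k0: "\<And>k. k \<ge> k0 \<Longrightarrow> dist (y (r (q k))) z < \<eta>"
      using tendstoD[OF q(2) \<eta>] unfolding eventually_sequentially by auto
    have "max K k0 \<le> r (q (max K k0))"
      using seq_suble[OF r(1), of "q (max K k0)"] seq_suble[OF q(1), of "max K k0"] by linarith
    then show ?thesis
      using k0[of "max K k0"] by (intro exI[of _ "r (q (max K k0))"]) (auto simp: dist_commute)
  qed
  then show ?thesis using * by metis
next
  case False
  have ev: "\<forall>\<^sub>F k in sequentially. R \<le> norm (y k)" for R
    using False unfolding cofinite_eq_sequentially[symmetric] eventually_cofinite
    by (metis (mono_tags, lifting) Collect_mono finite_subset nle_le)
  have "\<not> bounded (GG I \<phi>)"
  proof
    assume "bounded (GG I \<phi>)"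
    then obtain R where "\<And>x. x \<in> closure (GG I \<phi>) \<Longrightarrow> norm x \<le> R"
      using bounded_closure bounded_iff by metis
    then have "norm (y k) \<le> R" for k using y by blast
    moreover obtain k where "R + 1 \<le> norm (y k)"
      using ev[of "R + 1"] unfolding eventually_sequentially by blast
    ultimately show False by (metis add_le_same_cancel1 not_one_le_zero order_trans)
  qed
  then have poly: "polyhedral_refl I \<phi> \<gamma>" using dom by blast
  have V: "finite V" "frontier (GG I \<phi>) - Uset I \<phi> \<gamma> \<subseteq> V"
    using A2 by (simp_all add: Assumption2'_def)
  have "filterlim (\<lambda>k. norm (y k)) at_top sequentially"
    using ev by (simp add: filterlim_at_top)
  then show ?thesis by (rule polyhedral_barriers_at_infinity[OF poly V \<epsilon> y])
qed

text \<open>The data of \<open>Assumption2'\<close> are reused unchanged. Nonnegative pairing with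
  each \<open>\<gamma> i\<close> extends to the cone they generate, and off the boundary the cone is
  \<open>{0}\<close>.\<close>

lemma AssumptionV_if_Assumption2':
  assumes A2: "Assumption2' I \<phi> \<gamma> \<sigma> V"
  shows "AssumptionV \<sigma> I \<phi> \<gamma> V"
  unfolding AssumptionV_def
proof (intro conjI ballI)
  show "finite V" using A2 by (simp add: Assumption2'_def)
  fix x assume "x \<in> V"
  then obtain v r \<alpha> where *: "norm v = 1" "r > 0" "\<alpha> > 0"
    "\<And>y. y \<in> closure (GG I \<phi>) \<inter> cball x r \<Longrightarrow> \<alpha> * norm (y - x) \<le> inner v (y - x)
         \<and> (\<forall>i\<in>Idx I \<phi> y. 0 \<le> inner (\<gamma> i y) v)"
    "\<And>y. y \<in> cball x r \<Longrightarrow> \<alpha> \<le> inner v (amat \<sigma> y *v v)"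
    using A2 unfolding Assumption2'_def by meson
  have "0 \<le> inner v d" if y: "y \<in> closure (GG I \<phi>) \<inter> cball x r" and d: "d \<in> dcone I \<phi> \<gamma> y" for y d
  proof (cases "y \<in> frontier (GG I \<phi>)")
    case True
    then obtain s where s: "d = (\<Sum>i\<in>Idx I \<phi> y. s i *\<^sub>R \<gamma> i y)" "\<forall>i\<in>Idx I \<phi> y. 0 \<le> s i"
      using d by (auto simp: dcone_def)
    then show ?thesis
      using *(4)[OF y] by (auto simp: inner_sum_right inner_commute intro!: sum_nonneg)
  next
    case False
    then show ?thesis using d by (simp add: dcone_def)
  qed
  then show "\<exists>v \<alpha> r. norm v = 1 \<and> \<alpha> > 0 \<and> r > 0 \<and>
       (\<forall>y\<in>closure (GG I \<phi>) \<inter> cball x r.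
           inner v (y - x) \<ge> \<alpha> * norm (y - x)
         \<and> inner v (amat \<sigma> y *v v) \<ge> \<alpha>
         \<and> (\<forall>d\<in>dcone I \<phi> \<gamma> y. inner v d \<ge> 0))"
    using * by (intro exI[of _ v] exI[of _ \<alpha>] exI[of _ r]) auto
qed

theorem theorem3p5:
  fixes I :: "'i set"
    and \<phi> :: "'i \<Rightarrow> real^'J::finite \<Rightarrow> real"
    and \<gamma> :: "'i \<Rightarrow> real^'J \<Rightarrow> real^'J"
    and b :: "real^'J \<Rightarrow> real^'J"
    and \<sigma> :: "real^'J \<Rightarrow> real^'N::finite^'J"
    and V :: "(real^'J) set"
  assumes dom: "(pw_C1_refl I \<phi> \<gamma> \<and> bounded (GG I \<phi>)) \<or> polyhedral_refl I \<phi> \<gamma>"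
    and V_sub: "V \<subseteq> frontier (GG I \<phi>)"
    and A2: "Assumption2' I \<phi> \<gamma> \<sigma> V"
    and b_cont: "continuous_on UNIV b" and b_bdd: "bounded (range b)"
    and \<sigma>_cont: "continuous_on UNIV \<sigma>" and \<sigma>_bdd: "bounded (range \<sigma>)"
  shows "AssumptionTF b \<sigma> I \<phi> \<gamma> V \<and> AssumptionV \<sigma> I \<phi> \<gamma> V"
proof
  show "AssumptionTF b \<sigma> I \<phi> \<gamma> V"
    by (rule AssumptionTF_if_uniform_bumps[OF
          uniform_bumps_if_sequential_barriers[OF sequential_barriers[OF dom A2]] b_bdd \<sigma>_bdd])
  show "AssumptionV \<sigma> I \<phi> \<gamma> V" by (rule AssumptionV_if_Assumption2'[OF A2])
qed

end
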